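(* Let $m\ge1$, $n=2m$, $q=2^m$, $\mathbb{K}=\mathbb{F}_q\subset\mathbb{F}=\mathbb{F}_{q^2}$ and $1\le k<n$. The number $N_{m,k}$ of elements $C\in\mathbb{F}$ for which $P_{C,k}(X)=X^{2^k+1}+CX^{2^k}+C^qX+1$ has no solution $X\in\mathcal{P}_{q-1}$ is $$N_{m,k}=\big(q-\gcd(2^k+1,q+1)+1\big)\big(q-\#\mathrm{Im}(\Gamma_k)-1\big)+\frac{q+1}{\gcd(2^k-1,q+1)}-\gcd(2^k+1,q+1).$$ In particular, if $\gcd(k,m)=1$, then $N_{m,k}=(q-2)\frac{q+1}{3}$ if $m$ is odd, and $N_{m,k}=q\frac{q-1}{3}$ if $m$ is even.
   Context: $\mathcal{P}_{q-1}=\{X^{q-1}:X\in\mathbb{F}^*\}$ is the subgroup of $\mathbb{F}^*$ of order $q+1$. $\Gamma_k:\mathbb{K}\to\mathbb{K}$ is $\Gamma_k(x)=x^{2^k+1}+x$, and $\#\mathrm{Im}(\Gamma_k)$ is the size of its image. *)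

theory Defs
  imports
    "HOL-Algebra.Algebraic_Closure_Type"
    "HOL-Library.Cardinality"
    "HOL-Computational_Algebra.Computational_Algebra"
begin

definition nonzero_powers :: "nat \<Rightarrow> 'a::field set" where
  "nonzero_powers d = {x ^ d | x. x \<noteq> 0}"

text \<open>The image of the map \<open>K \<rightarrow> K\<close> given by this formula on a subfield \<open>K\<close>
  is \<open>Gamma_map k ` K\<close>.\<close>

definition Gamma_map :: "nat \<Rightarrow> 'a::field \<Rightarrow> 'a" where
  "Gamma_map k x = x ^ (2 ^ k + 1) + x"

definition P_poly :: "nat \<Rightarrow> nat \<Rightarrow> 'a::field \<Rightarrow> 'a poly" where
  "P_poly q k C =
     Polynomial.monom 1 (2 ^ k + 1) + Polynomial.monom C (2 ^ k) + Polynomial.monom (C ^ q) 1 + 1"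

end

theory Submission
  imports Defs "HOL-Number_Theory.Cong"
begin

text \<open>
  The elements \<open>C\<close> with a root are counted as the sum, over all pairs \<open>(X, C)\<close> with \<open>X\<close> a root of
  \<open>P\<^sub>C\<close> on the unit circle, of the reciprocal of the number of roots of \<open>P\<^sub>C\<close>. Fix \<open>X\<close>, put
  \<open>Q = 2 ^ k\<close> and \<open>Z = X ^ (Q + 1)\<close>; the admissible \<open>C\<close> form an affine line over \<open>K\<close>. Moving \<open>X\<close> to
  infinity, the remaining roots become the solutions in \<open>K\<close> of an affine equation
  \<open>w ^ Q + t * w = A\<close>. If \<open>Z \<noteq> 1\<close>, then \<open>A\<close> depends only on \<open>X\<close> and \<open>t\<close> runs over \<open>K\<close> without
  \<open>1\<close>, exactly as for the fibres of \<open>Gamma_map k\<close>, where \<open>A = 1\<close>; if \<open>Z = 1\<close>, then \<open>t = 1\<close> and \<open>A\<close>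
  varies. Scaling \<open>w\<close> shows that the sum over all \<open>t \<noteq> 0\<close> is the same for every \<open>A \<noteq> 0\<close>, and
  averaging over \<open>A\<close> gives its value. Whether \<open>t = 1\<close> is solvable, and the two greatest common
  divisors, are decided by the parities of \<open>k / gcd k m\<close> and \<open>m / gcd k m\<close>.
\<close>

section \<open>Greatest common divisors of numbers \<open>2 ^ a - 1\<close> and \<open>2 ^ a + 1\<close>\<close>

text \<open>Bezout is used in the subtraction-free form \<open>a * u = b * v + gcd a b\<close>, so
  no inverse of \<open>x\<close> is required; it needs \<open>a\<close> nonzero, hence the case
  split.\<close>

lemma power_gcd_eq_one:
  fixes x :: "'a::comm_monoid_mult"
  assumes "x ^ a = 1" "x ^ b = 1"
  shows "x ^ gcd a b = 1"
proof (cases "a = 0")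
  case False
  then obtain u v where "a * u = b * v + gcd a b"
    using bezout_nat by blast
  hence "(x ^ a) ^ u = (x ^ b) ^ v * x ^ gcd a b"
    by (metis power_add power_mult)
  thus ?thesis using assms by simp
qed (use assms in auto)

lemma power_dvd_eq_one:
  fixes x :: "'a::comm_monoid_mult"
  assumes "x ^ a = 1" "a dvd b"
  shows "x ^ b = 1"
  using assms by (metis dvdE power_mult power_one)

lemma power_eq_one_iff_gcd:
  fixes x :: "'a::comm_monoid_mult"
  shows "x ^ a = 1 \<and> x ^ b = 1 \<longleftrightarrow> x ^ gcd a b = 1"
  using power_gcd_eq_one power_dvd_eq_one by (metis gcd_dvd1 gcd_dvd2)

lemma dvd_two_power_minus_one_iff:
  fixes c :: nat
  shows "c dvd 2 ^ a - 1 \<longleftrightarrow> [2 ^ a = 1] (mod c)"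
  by (rule cong_altdef_nat[symmetric]) simp

text \<open>Modulo a common divisor \<open>c\<close>, the exponents \<open>e\<close> with
  \<open>2 ^ e = 1\<close> are closed under gcd by Bezout; conversely \<open>2 ^ e = 1\<close>
  passes to all multiples of \<open>e\<close>.\<close>

lemma gcd_two_power_minus_one:
  "gcd (2 ^ a - 1) (2 ^ b - 1 :: nat) = 2 ^ gcd a b - 1"
proof (rule dvd_antisym)
  define c :: nat where "c = gcd (2 ^ a - 1) (2 ^ b - 1)"
  have ab: "[2 ^ a = 1] (mod c)" "[2 ^ b = 1] (mod c)"
    unfolding c_def by (simp_all del: One_nat_def flip: dvd_two_power_minus_one_iff)
  have "[2 ^ gcd a b = 1] (mod c)"
  proof (cases "a = 0")
    case False
    then obtain u v where uv: "a * u = b * v + gcd a b"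
      using bezout_nat by blast
    have "[1 = ((2::nat) ^ a) ^ u] (mod c)"
      using cong_pow[OF ab(1), of u] by (simp add: cong_sym)
    also have "((2::nat) ^ a) ^ u = (2 ^ b) ^ v * 2 ^ gcd a b"
      by (metis uv power_add power_mult)
    also have "[\<dots> = 1 ^ v * 2 ^ gcd a b] (mod c)"
      by (intro cong_mult cong_pow ab) auto
    finally show ?thesis by (simp add: cong_sym)
  qed (use ab in auto)
  thus "c dvd 2 ^ gcd a b - 1"
    by (simp only: dvd_two_power_minus_one_iff)
next
  have "(2::nat) ^ gcd a b - 1 dvd 2 ^ c - 1" if "gcd a b dvd c" for c
  proof -
    from that obtain j where "c = gcd a b * j" by auto
    moreover have "[((2::nat) ^ gcd a b) ^ j = 1 ^ j] (mod (2 ^ gcd a b - 1))"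
      by (rule cong_pow) (simp only: flip: dvd_two_power_minus_one_iff, simp)
    ultimately show ?thesis
      by (metis dvd_two_power_minus_one_iff power_mult power_one)
  qed
  thus "2 ^ gcd a b - 1 dvd gcd (2 ^ a - 1) (2 ^ b - 1 :: nat)"
    by simp
qed

lemma int_dvd_two_power_plus_one_iff:
  "int c dvd 2 ^ j + 1 \<longleftrightarrow> c dvd 2 ^ j + 1"
  using int_dvd_int_iff[of c "2 ^ j + 1"] by (simp add: add.commute)

text \<open>Modulo a common divisor both powers of two are \<open>- 1\<close>. Raising them to the
  exponent \<open>lcm k m\<close> compares the parities of the two quotients, and Bezout then gives
  \<open>2 ^ d = - 1\<close>. Integers are used to have \<open>- 1\<close> available.\<close>

lemma gcd_two_power_plus_one:
  fixes k m :: nat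
  assumes "k > 0"
  defines "d \<equiv> gcd k m"
  shows "gcd (2 ^ k + 1) (2 ^ m + 1 :: nat)
           = (if odd (k div d) \<and> odd (m div d) then 2 ^ d + 1 else 1)"
proof -
  define c :: nat where "c = gcd (2 ^ k + 1) (2 ^ m + 1)"
  define k' m' where "k' = k div d" and "m' = m div d"
  have km: "k = d * k'" "m = d * m'" "d > 0"
    using assms unfolding k'_def m'_def d_def by auto
  have "int c dvd 2 ^ k + 1" "int c dvd 2 ^ m + 1"
    unfolding c_def int_dvd_two_power_plus_one_iff by (rule gcd_dvd1, rule gcd_dvd2)
  hence ck: "[2 ^ k = - 1] (mod int c)" and cm: "[2 ^ m = - 1] (mod int c)"
    by (simp_all add: cong_iff_dvd_diff)
  have c_odd: "odd c"
    using \<open>k > 0\<close> unfolding c_def by (auto dest: dvd_trans[OF _ gcd_dvd1])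
  have same: "odd k' \<longleftrightarrow> odd m'" if "c \<noteq> 1"
  proof (rule ccontr)
    assume neq: "\<not> (odd k' \<longleftrightarrow> odd m')"
    have "[(2 ^ k) ^ m' = (-1) ^ m'] (mod int c)" "[(2 ^ m) ^ k' = (-1) ^ k'] (mod int c)"
      by (intro cong_pow ck cm)+
    moreover have "((2::int) ^ k) ^ m' = (2 ^ m) ^ k'"
      by (simp add: km(1,2) mult_ac flip: power_mult)
    ultimately have "[(-1) ^ m' = (-1) ^ k'] (mod int c)"
      by (metis cong_sym cong_trans)
    hence "int c dvd 2"
      using neq by (auto simp: cong_iff_dvd_diff)
    hence "c dvd 2"
      by (metis int_dvd_int_iff of_nat_numeral)
    thus False using that c_odd by (metis dvd_refl prime_nat_iff two_is_prime_nat)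
  qed
  show ?thesis
  proof (cases "odd k' \<and> odd m'")
    case True
    have *: "2 ^ d + 1 dvd (2 ^ (d * j) + 1 :: nat)" if "odd j" for j
    proof -
      have "[((2::int) ^ d) ^ j = (-1) ^ j] (mod (2 ^ d + 1))"
        by (intro cong_pow) (simp add: cong_iff_dvd_diff)
      hence "(2 ^ d + 1 :: int) dvd 2 ^ (d * j) + 1"
        using that by (simp add: cong_iff_dvd_diff power_mult)
      thus ?thesis
        using int_dvd_two_power_plus_one_iff[of "2 ^ d + 1" "d * j"] by (simp add: add.commute)
    qed
    have "2 ^ d + 1 dvd c"
      unfolding c_def using * True km by (metis gcd_greatest)
    moreover have "c dvd 2 ^ d + 1"
    proof -
      obtain u v where uv: "k * u = m * v + d"
        using bezout_nat[of k m] \<open>k > 0\<close> unfolding d_def by blast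
      \<comment> \<open>Since \<open>k'\<close> and \<open>m'\<close> are odd, this relation forces
        \<open>u\<close> and \<open>v\<close> to have opposite parities, so that the signs in the
        congruence below leave \<open>2 ^ d + 1\<close>.\<close>
      hence "d * (k' * u) = d * (m' * v + 1)"
        using km(1,2) by (metis distrib_left mult.assoc mult.right_neutral)
      hence "k' * u = m' * v + 1"
        using \<open>d > 0\<close> by (metis mult_cancel1 neq0_conv)
      hence par: "even u \<longleftrightarrow> odd v"
        using True by (metis even_add even_mult_iff odd_one)
      have "[(-1) ^ u = ((2::int) ^ k) ^ u] (mod int c)"
        by (intro cong_pow cong_sym[OF ck])
      also have "((2::int) ^ k) ^ u = (2 ^ m) ^ v * 2 ^ d"
        by (metis uv power_add power_mult)
      also have "[\<dots> = (-1) ^ v * 2 ^ d] (mod int c)"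
        by (intro cong_mult cong_pow cm) auto
      finally have "int c dvd (-1) ^ u - (-1) ^ v * 2 ^ d"
        by (simp add: cong_iff_dvd_diff)
      hence "int c dvd 2 ^ d + 1"
        using par dvd_minus_iff[of "int c" "- 1 - 2 ^ d"] by (cases "even v") (auto simp: add.commute)
      thus ?thesis
        by (simp only: int_dvd_two_power_plus_one_iff)
    qed
    ultimately show ?thesis
      using True by (simp add: c_def k'_def m'_def dvd_antisym)
  next
    case False
    have "c = 1"
    proof (rule ccontr)
      \<comment> \<open>Equal parities that are not both odd are both even, and then
        \<open>2 * d\<close> would be a common divisor of \<open>k\<close> and
        \<open>m\<close>.\<close>
      assume "c \<noteq> 1"
      hence "even k'" "even m'" using same False by auto
      hence "d * 2 dvd k" "d * 2 dvd m"
        using km(1,2) by (metis mult_dvd_mono dvd_refl)+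
      hence "d * 2 dvd d" unfolding d_def by (rule gcd_greatest)
      thus False using \<open>d > 0\<close> by (auto dest: dvd_imp_le)
    qed
    thus ?thesis using False by (simp add: c_def k'_def m'_def)
  qed
qed

lemma not_both_even_div_gcd:
  fixes k m :: nat
  assumes "k > 0" "even (k div gcd k m)"
  shows "odd (m div gcd k m)"
proof -
  have "coprime (k div gcd k m) (m div gcd k m)"
    using assms(1) by (intro div_gcd_coprime) auto
  thus ?thesis
    using assms(2) by (metis coprime_common_divisor odd_one)
qed

lemma gcd_mult_coprime_right:
  fixes a b n :: nat
  assumes "coprime a b"
  shows "gcd n (a * b) = gcd n a * gcd n b"
proof (rule dvd_antisym)
  have "gcd n (a * b) dvd gcd n a * n" "gcd n (a * b) dvd gcd (n * b) (a * b)"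
    by (auto intro: dvd_mult dvd_mult2)
  thus "gcd n (a * b) dvd gcd n a * gcd n b"
    by (simp add: gcd_mult_distrib_nat mult.commute)
next
  have "coprime (gcd n a) (gcd n b)"
    using assms by (meson coprime_divisors gcd_dvd2)
  thus "gcd n a * gcd n b dvd gcd n (a * b)"
    by (simp add: divides_mult mult_dvd_mono)
qed

lemma coprime_two_power_pm_one:
  assumes "m > 0"
  shows "coprime (2 ^ m - 1) (2 ^ m + 1 :: nat)"
proof -
  have "gcd (2 ^ m - 1) (2 ^ m + 1 :: nat) dvd (2 ^ m + 1) - (2 ^ m - 1)"
    by (rule dvd_diff_nat[OF gcd_dvd2 gcd_dvd1])
  hence "gcd (2 ^ m - 1) (2 ^ m + 1 :: nat) dvd 2" by simp
  moreover have "odd (gcd (2 ^ m - 1) (2 ^ m + 1 :: nat))"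
    using assms by (auto dest: dvd_trans[OF _ gcd_dvd2])
  ultimately show ?thesis
    by (metis coprime_iff_gcd_eq_1 dvd_refl prime_nat_iff two_is_prime_nat)
qed

text \<open>The factors of \<open>2 ^ (2 * m) - 1 = (2 ^ m - 1) * (2 ^ m + 1)\<close> are coprime,
  so the gcd with the product splits. The product and its first factor are covered by the formula
  for numbers \<open>2 ^ a - 1\<close>, and the wanted gcd is their quotient.\<close>

lemma gcd_two_power_minus_plus_one:
  fixes k m :: nat
  assumes "k > 0" "m > 0"
  defines "d \<equiv> gcd k m"
  shows "gcd (2 ^ k - 1) (2 ^ m + 1 :: nat) = (if even (k div d) then 2 ^ d + 1 else 1)"
proof -
  define k' m' where "k' = k div d" and "m' = m div d"
  have km: "k = d * k'" "m = d * m'" "d > 0"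
    using assms unfolding k'_def m'_def d_def by auto
  have sq: "((2::nat) ^ j - 1) * (2 ^ j + 1) = 2 ^ (2 * j) - 1" for j
    by (simp add: algebra_simps power_mult power2_eq_square mult_2 power_add)
  have "(2 ^ d - 1) * gcd (2 ^ k - 1) (2 ^ m + 1 :: nat)
           = gcd (2 ^ k - 1) (2 ^ m - 1) * gcd (2 ^ k - 1) (2 ^ m + 1)"
    by (simp only: gcd_two_power_minus_one d_def)
  also have "\<dots> = gcd (2 ^ k - 1) (2 ^ (2 * m) - 1)"
    using assms(2) by (simp only: sq coprime_two_power_pm_one flip: gcd_mult_coprime_right)
  also have "\<dots> = 2 ^ gcd k (2 * m) - 1"
    by (rule gcd_two_power_minus_one)
  also have "gcd k (2 * m) = (if even k' then 2 * d else d)"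
  proof -
    have cop: "coprime k' m'"
      using assms unfolding k'_def m'_def d_def by (simp add: div_gcd_coprime)
    have "gcd k' (2 * m') = gcd k' 2"
      using cop by (simp add: gcd_mult_right_right_cancel coprime_commute)
    also have "\<dots> = (if even k' then 2 else 1)"
      by (metis coprime_iff_gcd_eq_1 coprime_right_2_iff_odd gcd_nat.absorb2)
    finally have "d * gcd k' (2 * m') = (if even k' then 2 * d else d)"
      by simp
    thus ?thesis
      unfolding gcd_mult_distrib_nat by (metis km(1,2) mult.left_commute)
  qed
  also have "2 ^ \<dots> - (1::nat) = (2 ^ d - 1) * (if even k' then 2 ^ d + 1 else 1)"
    using sq[of d] by simp
  finally have "gcd (2 ^ k - 1) (2 ^ m + 1) = (if even k' then 2 ^ d + 1 else (1::nat))"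
    using \<open>d > 0\<close> power_strict_increasing[of 0 d "2::nat"] by (simp only: mult_cancel1) simp
  thus ?thesis by (simp only: k'_def)
qed

section \<open>Finite fields of characteristic two\<close>

text \<open>Weighting each element by the reciprocal of the size of its fibre makes every fibre
  contribute exactly 1.\<close>

lemma card_image_eq_sum_inverse_fibers:
  assumes "finite A"
  shows "real (card (f ` A)) = (\<Sum>x\<in>A. 1 / real (card {y\<in>A. f y = f x}))"
proof -
  have "(\<Sum>x\<in>A. 1 / real (card {y\<in>A. f y = f x}))
          = (\<Sum>b\<in>f ` A. \<Sum>x\<in>{x\<in>A. f x = b}. 1 / real (card {y\<in>A. f y = f x}))"
    by (rule sum.image_gen[OF assms])
  also have "\<dots> = (\<Sum>b\<in>f ` A. 1)"
  proof (rule sum.cong[OF refl])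
    fix b assume "b \<in> f ` A"
    hence "card {x\<in>A. f x = b} > 0"
      using assms by (auto simp: card_gt_0_iff)
    moreover have "(\<Sum>x\<in>{x\<in>A. f x = b}. 1 / real (card {y\<in>A. f y = f x}))
        = (\<Sum>x\<in>{x\<in>A. f x = b}. 1 / real (card {y\<in>A. f y = b}))"
      by (rule sum.cong) auto
    ultimately show "(\<Sum>x\<in>{x\<in>A. f x = b}. 1 / real (card {y\<in>A. f y = f x})) = 1"
      by simp
  qed
  finally show ?thesis by simp
qed

text \<open>Every nonzero element is a root of \<open>X ^ (e * f) - 1\<close>, the product of
  \<open>X ^ e - 1\<close> and a cofactor with at most \<open>e * (f - 1)\<close> roots. This leaves
  at least \<open>e\<close> roots for the first factor, whose degree allows no more.\<close>

lemma card_roots_of_unity_finite_field: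
  assumes e: "e dvd CARD('a::finite_field) - 1"
  shows "card {x::'a. x ^ e = 1} = e"
proof -
  have C2: "CARD('a) \<ge> 2"
    using card_mono[of UNIV "{0, 1::'a}"] by simp
  obtain f where f: "CARD('a) - 1 = e * f"
    using e by auto
  hence pos: "e > 0" "f > 0"
    using C2 by (auto intro!: Nat.gr0I)
  \<comment> \<open>The cofactor is the geometric sum in \<open>X ^ e\<close>; its constant term 1
    shows that it is not zero.\<close>
  define c :: "'a poly" where "c = (\<Sum>i<f. Polynomial.monom 1 (e * i))"
  have c0: "coeff c 0 = 1"
    using pos by (simp add: c_def coeff_sum sum.delta)
  have "degree c \<le> e * (f - 1)"
    unfolding c_def
    by (intro degree_sum_le) (auto intro!: order.trans[OF degree_monom_le] mult_le_mono2)
  hence cof: "card {x. poly c x = 0} \<le> e * (f - 1)"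
    using card_poly_roots_bound[of c] c0 by fastforce
  have deg: "degree (Polynomial.monom 1 e - 1 :: 'a poly) \<le> e"
    by (intro degree_diff_le) (auto simp: degree_monom_eq)
  have "coeff (Polynomial.monom 1 e - 1 :: 'a poly) e = 1"
    using pos by (simp add: coeff_1)
  hence "card {x. poly (Polynomial.monom 1 e - 1 :: 'a poly) x = 0} \<le> e"
    using card_poly_roots_bound[of "Polynomial.monom 1 e - 1 :: 'a poly"] deg by fastforce
  hence le: "card {x::'a. x ^ e = 1} \<le> e"
    by (simp add: poly_monom)
  have "UNIV - {0} \<subseteq> {x::'a. x ^ e = 1} \<union> {x. poly c x = 0}"
  proof
    fix x :: 'a assume "x \<in> UNIV - {0}"
    hence "x \<noteq> 0" by simp
    have "x * x ^ (CARD('a) - 1) = x * 1"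
      using finite_field_power_card_eq_same[of x] C2 by (simp flip: power_Suc)
    hence "(x ^ e) ^ f = 1"
      using \<open>x \<noteq> 0\<close> f by (simp add: power_mult)
    hence "(x ^ e - 1) * (\<Sum>i<f. (x ^ e) ^ i) = 0"
      by (simp flip: power_diff_1_eq)
    thus "x \<in> {x. x ^ e = 1} \<union> {x. poly c x = 0}"
      by (auto simp: c_def poly_sum poly_monom power_mult)
  qed
  hence "card (UNIV - {0::'a}) \<le> card ({x::'a. x ^ e = 1} \<union> {x. poly c x = 0})"
    by (intro card_mono) auto
  also have "\<dots> \<le> card {x::'a. x ^ e = 1} + card {x. poly c x = 0}"
    by (rule card_Un_le)
  finally have "e * f \<le> card {x::'a. x ^ e = 1} + e * (f - 1)"
    using cof f by simp
  with le pos show ?thesis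
    by (cases f) auto
qed

lemma sum_card_fibers:
  assumes "finite A" "finite B" "f ` A \<subseteq> B"
  shows "(\<Sum>b\<in>B. card {x\<in>A. f x = b}) = card A"
  using sum.group[OF assms, of "\<lambda>_. 1::nat"] by simp

section \<open>The field of order \<open>q ^ 2\<close>, its subfield \<open>K\<close> and its unit
  circle \<open>U\<close>\<close>

locale char2_quadratic =
  fixes m k q Q :: nat and ty :: "'a::finite_field itself"
  assumes m: "m \<ge> 1" and k: "k \<ge> 1" and q: "q = 2 ^ m" and Q: "Q = 2 ^ k"
    and card_field: "CARD('a) = q ^ 2"
begin

text \<open>The subfield of order \<open>q\<close>, encoded as the fixed points of the
  \<open>q\<close>-Frobenius; the given subfield is identified with it at the end.\<close>

definition K :: "'a set" where "K = {x. x ^ q = x}"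

text \<open>The elements of norm 1 over \<open>K\<close>.\<close>

definition U :: "'a set" where "U = {x. x ^ (q + 1) = 1}"

lemma q_ge2: "q \<ge> 2" and Q_ge2: "Q \<ge> 2"
  using m k power_increasing[of 1 m "2::nat"] power_increasing[of 1 k "2::nat"]
  by (auto simp: q Q)

text \<open>Translation by 1 permutes the field, so the sum of all elements absorbs
  \<open>CARD('a)\<close> copies of 1. The characteristic therefore divides a power of two.\<close>

lemma CHAR_2: "CHAR('a) = 2"
proof -
  have "(\<Sum>x\<in>(UNIV::'a set). x) = (\<Sum>x\<in>UNIV. x + 1)"
    by (rule sum.reindex_bij_witness[of _ "\<lambda>x. x + 1" "\<lambda>x. x - 1"]) auto
  hence "of_nat (CARD('a)) = (0::'a)"
    by (simp add: sum.distrib)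
  hence "CHAR('a) dvd 2 ^ (m * 2)"
    by (simp only: card_field q of_nat_eq_0_iff_char_dvd flip: power_mult)
  hence "CHAR('a) dvd 2"
    using CHAR_prime prime_dvd_power by blast
  thus ?thesis
    using CHAR_prime[where ?'a = 'a] by (metis primes_dvd_imp_eq two_is_prime_nat)
qed

lemma add_self [simp]: "x + x = (0::'a)"
  by (metis CHAR_2 add.right_inverse uminus_CHAR_2)

lemma minus_eq [simp]: "- x = (x::'a)"
  by (simp add: CHAR_2 uminus_CHAR_2)

lemma add_self_left [simp]: "x + (x + y) = (y::'a)"
  by (simp flip: add.assoc)

lemma add_eq_0 [simp]: "x + y = (0::'a) \<longleftrightarrow> x = y"
  by (simp add: eq_neg_iff_add_eq_0[symmetric])

lemma two_eq_0 [simp]: "(2::'a) = 0"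
  by (metis add_self one_add_one)

lemma power_two_power_add: "(x + y :: 'a) ^ (2 ^ j) = x ^ (2 ^ j) + y ^ (2 ^ j)"
  by (rule freshmans_dream') (simp_all add: CHAR_2)

lemma power_q_add: "(x + y :: 'a) ^ q = x ^ q + y ^ q"
  and power_Q_add: "(x + y :: 'a) ^ Q = x ^ Q + y ^ Q"
  by (simp_all add: q Q power_two_power_add)

lemma power_q_Q: "((x::'a) ^ Q) ^ q = (x ^ q) ^ Q"
  by (simp add: mult.commute flip: power_mult)

lemma power_q_q [simp]: "((x::'a) ^ q) ^ q = x"
  using finite_field_power_card_eq_same[of x] by (simp add: card_field power2_eq_square power_mult)

lemma power_Q_inj: "(x::'a) ^ Q = y ^ Q \<longleftrightarrow> x = y"
proof
  assume "x ^ Q = y ^ Q"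
  hence "(x + y) ^ Q = 0" by (simp add: power_Q_add)
  thus "x = y" by simp
qed simp

lemma K_0 [simp]: "0 \<in> K" and K_1 [simp]: "1 \<in> K"
  using q_ge2 by (auto simp: K_def)

lemma K_add [simp]: "x \<in> K \<Longrightarrow> y \<in> K \<Longrightarrow> x + y \<in> K"
  and K_mult [simp]: "x \<in> K \<Longrightarrow> y \<in> K \<Longrightarrow> x * y \<in> K"
  and K_divide [simp]: "x \<in> K \<Longrightarrow> y \<in> K \<Longrightarrow> x / y \<in> K"
  and K_power [simp]: "x \<in> K \<Longrightarrow> x ^ j \<in> K"
  by (auto simp: K_def power_q_add power_mult_distrib power_divide mult.commute[of j q] power_mult simp flip: power_mult)
     (simp add: power_mult mult.commute[of j q])

lemma K_power_Q_surj:
  assumes "a \<in> K"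
  obtains b where "b \<in> K" "b ^ Q = a"
proof -
  have "(\<lambda>b. b ^ Q) ` K = K"
    by (intro endo_inj_surj) (auto simp: inj_on_def power_Q_inj)
  thus ?thesis using assms that by (metis imageE)
qed

lemma q_square_minus_one: "CARD('a) - 1 = (q - 1) * (q + 1)"
  by (simp add: card_field algebra_simps power2_eq_square)

lemma card_U: "card U = q + 1"
  unfolding U_def by (rule card_roots_of_unity_finite_field) (simp only: q_square_minus_one dvd_triv_left dvd_triv_right)

lemma K_nonzero: "K - {0} = {x. x ^ (q - 1) = 1}"
proof -
  have "x ^ q = x * x ^ (q - 1)" for x :: 'a
    using q_ge2 by (simp flip: power_Suc)
  thus ?thesis using q_ge2 by (auto simp: K_def power_0_left)
qed

lemma card_K_nonzero: "card (K - {0}) = q - 1"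
  unfolding K_nonzero by (rule card_roots_of_unity_finite_field) (simp only: q_square_minus_one dvd_triv_left dvd_triv_right)

lemma card_K: "card K = q"
  using card_K_nonzero q_ge2 by (simp add: card_Diff_singleton)

lemma U_nonzero: "x \<in> U \<Longrightarrow> x \<noteq> 0"
  by (auto simp: U_def)

lemma U_power_q: "x \<in> U \<Longrightarrow> x ^ q = inverse x"
  using U_nonzero[of x] by (auto simp: U_def field_simps)

text \<open>One inclusion is \<open>x ^ (q ^ 2 - 1) = 1\<close>. For equality the cardinalities are
  compared: the fibres of the power map are cosets of \<open>K - {0}\<close>, so the image has
  \<open>q + 1\<close> elements.\<close>

lemma nonzero_powers_eq_U: "nonzero_powers (q - 1) = U"
proof (rule card_subset_eq)
  show "nonzero_powers (q - 1) \<subseteq> U"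
  proof
    fix y :: 'a assume "y \<in> nonzero_powers (q - 1)"
    then obtain x where x: "x \<noteq> 0" "y = x ^ (q - 1)" by (auto simp: nonzero_powers_def)
    have "x * x ^ (CARD('a) - 1) = x * 1"
      using finite_field_power_card_eq_same[of x] by (simp flip: power_Suc)
    hence "x ^ (CARD('a) - 1) = 1"
      using x(1) by (simp only: mult_cancel_left) simp
    thus "y \<in> U"
      by (simp only: U_def x(2) mem_Collect_eq flip: power_mult q_square_minus_one)
  qed
  have np: "nonzero_powers (q - 1) = (\<lambda>x::'a. x ^ (q - 1)) ` (UNIV - {0})"
    by (auto simp: nonzero_powers_def)
  have fib: "card {y \<in> UNIV - {0::'a}. y ^ (q - 1) = x ^ (q - 1)} = q - 1" if "x \<noteq> 0" for x
  proof -
    have "card {y \<in> UNIV - {0::'a}. y ^ (q - 1) = x ^ (q - 1)} = card {u::'a. u ^ (q - 1) = 1}"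
      by (rule bij_betw_same_card[of "\<lambda>y. y / x"], rule bij_betw_byWitness[of _ "\<lambda>u. u * x"])
         (use that q_ge2 in \<open>auto simp: power_divide power_mult_distrib power_0_left\<close>)
    thus ?thesis using card_K_nonzero by (simp add: K_nonzero)
  qed
  have "real (card (nonzero_powers (q - 1) :: 'a set))
          = (\<Sum>x\<in>UNIV - {0::'a}. 1 / real (card {y \<in> UNIV - {0}. y ^ (q - 1) = x ^ (q - 1)}))"
    unfolding np by (rule card_image_eq_sum_inverse_fibers) simp
  also have "\<dots> = (\<Sum>x\<in>UNIV - {0::'a}. 1 / real (q - 1))"
    by (rule sum.cong[OF refl]) (subst fib, auto)
  also have "\<dots> = real (CARD('a) - 1) / real (q - 1)"
    by (simp add: card_Diff_singleton)
  also have "\<dots> = real (q + 1)"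
    using q_ge2 unfolding q_square_minus_one by (subst of_nat_mult) simp
  finally show "card (nonzero_powers (q - 1) :: 'a set) = card U"
    by (simp add: card_U)
qed simp

section \<open>The affine equations\<close>

definition psi :: "'a \<Rightarrow> 'a \<Rightarrow> nat" where
  "psi t A = card {w \<in> K. w ^ Q + t * w = A}"

text \<open>\<open>psi\<close> will count the members of a fibre other than a chosen one; the
  summand 1 restores that one, so \<open>phi\<close> is the weight of an element of the
  fibre.\<close>

definition phi :: "'a \<Rightarrow> 'a \<Rightarrow> real" where
  "phi t A = 1 / (1 + real (psi t A))"

text \<open>The left side of the equation is additive in \<open>w\<close>, so the solution set is
  empty or a coset of the kernel.\<close>

lemma psi_cases: "psi t A = 0 \<or> psi t A = psi t 0"
proof (cases "\<exists>w\<in>K. w ^ Q + t * w = A")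
  case True
  then obtain v where v: "v \<in> K" "v ^ Q + t * v = A" by auto
  have *: "(w + v) ^ Q + t * (w + v) = (w ^ Q + t * w) + A" for w
    unfolding v(2)[symmetric] by (simp add: power_Q_add distrib_left ac_simps)
  have **: "(w + v) ^ Q = t * (w + v) \<longleftrightarrow> w ^ Q + t * w = A" for w
    using *[of w] by (metis add_eq_0)
  have "psi t A = psi t 0"
    unfolding psi_def
    by (rule bij_betw_same_card[of "\<lambda>w. w + v"], rule bij_betw_byWitness[of _ "\<lambda>w. w + v"])
       (use v in \<open>auto simp: * **\<close>)
  thus ?thesis ..
next
  case False
  hence "{w \<in> K. w ^ Q + t * w = A} = {}" by blast
  thus ?thesis by (simp add: psi_def)
qed

text \<open>Because \<open>psi t A\<close> takes only two values, the reciprocal is an affine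
  function of it; this makes sums over \<open>A\<close> computable.\<close>

lemma phi_eq: "phi t A = 1 - real (psi t A) / (1 + real (psi t 0))"
  using psi_cases[of t A] by (auto simp: phi_def divide_simps)

lemma sum_phi_K:
  assumes "t \<in> K"
  shows "(\<Sum>A\<in>K. phi t A) = real q - real q / (1 + real (psi t 0))"
proof -
  have "(\<Sum>A\<in>K. psi t A) = card K"
    unfolding psi_def using assms by (intro sum_card_fibers) auto
  hence "(\<Sum>A\<in>K. real (psi t A)) = real q"
    by (metis card_K of_nat_sum)
  thus ?thesis
    by (simp add: phi_eq sum_subtractf card_K flip: sum_divide_distrib)
qed

text \<open>The order of the field of elements of \<open>K\<close> fixed by the
  \<open>Q\<close>-Frobenius.\<close>

definition del :: nat where "del = 2 ^ gcd k m"

lemma del_ge2: "del \<ge> 2"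
  using k power_increasing[of 1 "gcd k m" "2::nat"] by (simp add: del_def Suc_le_eq)

lemma gcd_Q_q_minus_one: "gcd (Q - 1) (q - 1) = del - 1"
  by (simp only: Q q del_def gcd_two_power_minus_one)

text \<open>A nonempty fibre is a coset of the kernel of the power map on \<open>K - {0}\<close>,
  which consists of the roots of unity of exponent
  \<open>gcd (Q - 1) (q - 1) = del - 1\<close>.\<close>

lemma card_power_Q_minus_one_fiber:
  "card {w \<in> K - {0}. w ^ (Q - 1) = t} \<in> {0, del - 1}"
proof (cases "\<exists>v\<in>K-{0}. v ^ (Q - 1) = t")
  case True
  then obtain v where v: "v \<in> K" "v \<noteq> 0" "v ^ (Q - 1) = t" by auto
  have "card {w \<in> K - {0}. w ^ (Q - 1) = t} = card {u \<in> K - {0}. u ^ (Q - 1) = 1}"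
    by (rule bij_betw_same_card[of "\<lambda>w. w / v"], rule bij_betw_byWitness[of _ "\<lambda>w. w * v"])
       (use v in \<open>auto simp: power_divide power_mult_distrib\<close>)
  also have "{u \<in> K - {0}. u ^ (Q - 1) = 1} = {u. u ^ (del - 1) = 1}"
    unfolding K_nonzero gcd_Q_q_minus_one[symmetric] by (simp flip: power_eq_one_iff_gcd) blast
  also have "card \<dots> = del - 1"
    by (rule card_roots_of_unity_finite_field)
       (simp only: q_square_minus_one dvd_mult2 gcd_dvd2 flip: gcd_Q_q_minus_one)
  finally show ?thesis by simp
next
  case False
  hence "{w \<in> K - {0}. w ^ (Q - 1) = t} = {}" by blast
  thus ?thesis by simp
qed

lemma psi_0: "psi t 0 = 1 + card {w \<in> K - {0}. w ^ (Q - 1) = t}"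
proof -
  have "w ^ Q = w * w ^ (Q - 1)" for w :: 'a
    using Q_ge2 by (simp flip: power_Suc)
  hence "{w \<in> K. w ^ Q + t * w = 0} = insert 0 {w \<in> K - {0}. w ^ (Q - 1) = t}"
    by (auto simp: mult.commute)
  thus ?thesis by (simp add: psi_def)
qed

lemma psi_1_0: "psi 1 0 = del"
proof -
  have "card {w \<in> K - {0}. w ^ (Q - 1) = 1} > 0"
    by (subst card_gt_0_iff) (auto intro: exI[of _ 1])
  thus ?thesis
    using card_power_Q_minus_one_fiber[of 1] del_ge2
    unfolding psi_0 by (simp only: insert_iff empty_iff) arith
qed

section \<open>Sums of \<open>phi\<close> over the coefficient \<open>t\<close>\<close>

definition total :: "'a \<Rightarrow> real" where
  "total A = (\<Sum>t\<in>K - {0}. phi t A)"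

lemma total_0: "total 0 = (real q - 1) * real del / (2 * (real del + 1))"
proof -
  let ?c = "\<lambda>t. card {w \<in> K - {0}. w ^ (Q - 1) = t}"
  \<comment> \<open>The fibre size is 0 or \<open>del - 1\<close>, so \<open>1 / (2 + c)\<close> is
    again affine in it, and the fibre sizes add up to \<open>q - 1\<close>.\<close>
  have "phi t 0 = 1 / 2 - real (?c t) / (2 * (real del + 1))" for t
  proof -
    define c where "c = real (?c t)"
    have "c = 0 \<or> c = real del - 1"
      unfolding c_def
      using card_power_Q_minus_one_fiber[of t] del_ge2 by (auto simp: of_nat_diff)
    moreover have "phi t 0 = 1 / (2 + c)"
      by (simp add: phi_def psi_0 c_def)
    ultimately have "phi t 0 = 1 / 2 - c / (2 * (real del + 1))"
      by (elim disjE) (simp_all add: field_simps)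
    thus ?thesis by (simp only: c_def)
  qed
  hence "total 0 = (\<Sum>t\<in>K - {0}. 1 / 2 - real (?c t) / (2 * (real del + 1)))"
    by (simp add: total_def)
  also have "\<dots> = real (q - 1) / 2 - real (\<Sum>t\<in>K - {0}. ?c t) / (2 * (real del + 1))"
    by (simp add: sum_subtractf card_K_nonzero del: sum_constant flip: sum_divide_distrib)
       (simp add: card_K_nonzero)
  also have "(\<Sum>t\<in>K - {0}. ?c t) = q - 1"
    using card_K_nonzero by (subst sum_card_fibers) auto
  finally show ?thesis
    using q_ge2 by (simp add: of_nat_diff field_simps)
qed

text \<open>With \<open>l ^ Q = A\<close>, the substitution \<open>w = l * v\<close> normalises the
  right side to 1 and replaces \<open>t\<close> by \<open>t * l / A\<close>, which permutes the
  nonzero elements of \<open>K\<close>.\<close>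

lemma total_eq_total_1:
  assumes "A \<in> K" "A \<noteq> 0"
  shows "total A = total 1"
proof -
  obtain l where l: "l \<in> K" "l ^ Q = A" using K_power_Q_surj assms(1) .
  have l0: "l \<noteq> 0" using l assms(2) Q_ge2 by auto
  have "phi t A = phi (t * l / A) 1" for t
  proof -
    have "psi t A = psi (t * l / A) 1"
      unfolding psi_def
      by (rule bij_betw_same_card[of "\<lambda>w. w / l"], rule bij_betw_byWitness[of _ "\<lambda>w. w * l"])
         (use l l0 assms in \<open>auto simp: power_divide power_mult_distrib field_simps\<close>)
    thus ?thesis by (simp add: phi_def)
  qed
  thus ?thesis
    unfolding total_def
    by (intro sum.reindex_bij_witness[of _ "\<lambda>t. t * A / l" "\<lambda>t. t * l / A"])
       (use l l0 assms in auto)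
qed

text \<open>The sum of \<open>total A\<close> over \<open>A\<close> in \<open>K\<close> is evaluated
  twice: summing over \<open>A\<close> first expresses it through \<open>total 0\<close>, while all
  terms with \<open>A\<close> nonzero equal \<open>total 1\<close>.\<close>

lemma total_1: "total 1 = real q - (real q + 1) * real del / (2 * (real del + 1))"
proof -
  have "(\<Sum>A\<in>K. total A) = (\<Sum>t\<in>K - {0}. \<Sum>A\<in>K. phi t A)"
    unfolding total_def by (rule sum.swap)
  also have "\<dots> = (\<Sum>t\<in>K - {0}. real q - real q * phi t 0)"
    by (rule sum.cong) (auto simp: sum_phi_K phi_def[of _ 0])
  also have "\<dots> = (real q - 1) * real q - real q * total 0"
    using q_ge2 by (simp add: sum_subtractf total_def card_K_nonzero of_nat_diff flip: sum_distrib_left)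
  also have "(\<Sum>A\<in>K. total A) = total 0 + (\<Sum>A\<in>K - {0}. total A)"
    by (subst sum.remove[of _ 0]) auto
  also have "(\<Sum>A\<in>K - {0}. total A) = (\<Sum>A\<in>K - {0}. total 1)"
    by (intro sum.cong total_eq_total_1) auto
  also have "\<dots> = (real q - 1) * total 1"
    using q_ge2 by (simp add: card_K_nonzero of_nat_diff)
  finally have "(real q - 1) * total 1 = (real q - 1) * real q - (real q + 1) * total 0"
    by (simp add: algebra_simps)
  also have "\<dots> = (real q - 1) * (real q - (real q + 1) * real del / (2 * (real del + 1)))"
    by (simp add: total_0 algebra_simps)
  finally show ?thesis using q_ge2 by simp
qed

lemma power_Suc_Q: "(x::'a) ^ (2 ^ k + 1) = x ^ Q * x"
  by (simp add: Q)

lemma divide_plus_one: "(y::'a) \<noteq> 0 \<Longrightarrow> x / y + 1 = (x + y) / y"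
  by (simp add: add_divide_distrib)

lemma add_self_right [simp]: "(x + y) + y = (x::'a)"
  by (simp add: add.assoc)

lemma psi_0_left:
  assumes "A \<in> K"
  shows "psi 0 A = 1"
proof -
  obtain l where "l \<in> K" "l ^ Q = A" using K_power_Q_surj assms .
  hence "{w \<in> K. w ^ Q + 0 * w = A} = {l}"
    using power_Q_inj by auto
  thus ?thesis by (simp add: psi_def)
qed

text \<open>Both fibre counts below lead to the parameter \<open>x / (x + 1)\<close>, which misses only the
  value \<open>1\<close>; \<open>x = 1\<close> corresponds to the point at infinity.\<close>

lemma sum_phi_reparam:
  assumes "A \<in> K"
  shows "(\<Sum>x\<in>K - {1}. phi (x / (x + 1)) A) = 1 / 2 + total A - phi 1 A"
proof -
  \<comment> \<open>In characteristic two this substitution is an involution, so it permutes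
    \<open>K - {1}\<close>.\<close>
  have inv: "x / (x + 1) / (x / (x + 1) + 1) = x" if "x \<noteq> 1" for x :: 'a
  proof -
    have "x + 1 \<noteq> 0" using that by simp
    hence "x / (x + 1) + 1 = 1 / (x + 1)"
      by (simp add: divide_plus_one)
    thus ?thesis using that by simp
  qed
  have "(\<Sum>x\<in>K - {1}. phi (x / (x + 1)) A) = (\<Sum>t\<in>K - {1}. phi t A)"
    by (rule sum.reindex_bij_witness[of _ "\<lambda>x. x / (x + 1)" "\<lambda>x. x / (x + 1)"])
       (auto simp: inv[simplified] divide_eq_1_iff)
  also have "\<dots> = (\<Sum>t\<in>K - {0}. phi t A) + phi 0 A - phi 1 A"
    by (simp add: sum_diff1)
  finally show ?thesis
    using psi_0_left[OF assms] by (simp add: total_def phi_def[of 0])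
qed

section \<open>The image of \<open>Gamma_map k\<close>\<close>

text \<open>For \<open>y = x + u\<close>, dividing the difference of the two values by
  \<open>u ^ (Q + 1)\<close> gives an affine equation in \<open>(x + 1) / u\<close>. The summand 1
  stands for \<open>y = x\<close>.\<close>

lemma Gamma_fiber:
  assumes x: "x \<in> K" "x \<noteq> 1"
  shows "card {y \<in> K. Gamma_map k y = Gamma_map k x} = 1 + psi (x / (x + 1)) 1"
proof -
  have key: "Gamma_map k (x + u) = Gamma_map k x \<longleftrightarrow>
      ((x + 1) / u) ^ Q + x / (x + 1) * ((x + 1) / u) = 1" if "u \<noteq> 0" for u
  proof -
    have "Gamma_map k (x + u) = Gamma_map k x \<longleftrightarrow> Gamma_map k (x + u) + Gamma_map k x = 0"
      by simp
    also have "Gamma_map k (x + u) + Gamma_map k x = (x ^ Q + 1) * u + x * u ^ Q + u ^ Q * u"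
      unfolding Gamma_map_def power_Suc_Q by (simp add: power_Q_add algebra_simps)
    also have "\<dots> = 0 \<longleftrightarrow> (x ^ Q + 1) * u + x * u ^ Q = u ^ Q * u"
      by (rule add_eq_0)
    also have "\<dots> \<longleftrightarrow> (x ^ Q + 1) / u ^ Q + x / u = 1"
      using that by (simp add: add_frac_eq)
    also have "(x ^ Q + 1) / u ^ Q + x / u = ((x + 1) / u) ^ Q + x / (x + 1) * ((x + 1) / u)"
      using x by (simp add: power_divide power_Q_add)
    finally show ?thesis .
  qed
  have "psi (x / (x + 1)) 1 = card {y \<in> K - {x}. Gamma_map k y = Gamma_map k x}"
    unfolding psi_def
  proof (rule bij_betw_same_card[of "\<lambda>v. x + (x + 1) / v"],
      rule bij_betw_byWitness[of _ "\<lambda>y. (x + 1) / (y + x)"], goal_cases)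
    case 1
    show ?case using x by (auto simp: add.commute)
  next
    case 2
    show ?case using x by (auto simp: add.commute)
  next
    case 3
    have *: "x + (x + 1) / v \<in> {y \<in> K - {x}. Gamma_map k y = Gamma_map k x}"
      if v: "v \<in> K" "v ^ Q + x / (x + 1) * v = 1" for v
    proof -
      have "v \<noteq> 0" using v Q_ge2 by (auto simp: power_0_left)
      thus ?thesis using v x by (simp add: key)
    qed
    show ?case by (intro image_subsetI, elim CollectE conjE) (rule *, assumption+)
  next
    case 4
    have *: "(x + 1) / (y + x) \<in> {v \<in> K. v ^ Q + x / (x + 1) * v = 1}"
      if y: "y \<in> K - {x}" "Gamma_map k y = Gamma_map k x" for y
    proof -
      have "x + (y + x) = y" by (simp only: add.commute[of y] add_self_left)
      hence "Gamma_map k (x + (y + x)) = Gamma_map k x" using y(2) by (simp only:)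
      moreover have "y + x \<noteq> 0" using y by simp
      ultimately have "((x + 1) / (y + x)) ^ Q + x / (x + 1) * ((x + 1) / (y + x)) = 1"
        by (intro iffD1[OF key])
      thus ?thesis using x y by simp
    qed
    show ?case by (intro image_subsetI, elim CollectE conjE) (rule *, assumption+)
  qed
  moreover have "card {y \<in> K. Gamma_map k y = Gamma_map k x}
      = Suc (card ({y \<in> K. Gamma_map k y = Gamma_map k x} - {x}))"
    using x by (intro card.remove) auto
  moreover have "{y \<in> K. Gamma_map k y = Gamma_map k x} - {x}
      = {y \<in> K - {x}. Gamma_map k y = Gamma_map k x}"
    by blast
  ultimately show ?thesis by simp
qed

lemma Gamma_fiber_1: "card {y \<in> K. Gamma_map k y = Gamma_map k 1} = 2"
proof -
  have "{y \<in> K. Gamma_map k y = Gamma_map k 1} = {0, 1}"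
  proof -
    \<comment> \<open>Keeping \<open>1 ^ Q\<close> unsimplified lets the injectivity of the
      \<open>Q\<close>-Frobenius turn the first factor into \<open>y = 1\<close>.\<close>
    have "Gamma_map k y = (y ^ Q + 1 ^ Q) * y" for y :: 'a
      unfolding Gamma_map_def power_Suc_Q by (simp add: algebra_simps)
    thus ?thesis by (auto simp: power_Q_inj simp del: power_one)
  qed
  thus ?thesis by simp
qed

text \<open>The leading 1 consists of two halves: the weight of \<open>x = 1\<close>, whose fibre
  has two elements, and \<open>phi 0 1\<close>.\<close>

lemma card_Gamma_image: "real (card (Gamma_map k ` K)) = 1 + total 1 - phi 1 1"
proof -
  have "real (card (Gamma_map k ` K))
      = (\<Sum>x\<in>K. 1 / real (card {y \<in> K. Gamma_map k y = Gamma_map k x}))"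
    by (rule card_image_eq_sum_inverse_fibers) simp
  also have "\<dots> = 1 / 2 + (\<Sum>x\<in>K - {1}. 1 / real (card {y \<in> K. Gamma_map k y = Gamma_map k x}))"
    by (subst sum.remove[of _ 1]) (simp_all add: Gamma_fiber_1)
  also have "(\<Sum>x\<in>K - {1}. 1 / real (card {y \<in> K. Gamma_map k y = Gamma_map k x}))
      = (\<Sum>x\<in>K - {1}. phi (x / (x + 1)) 1)"
    by (rule sum.cong) (auto simp: Gamma_fiber phi_def)
  also have "\<dots> = 1 / 2 + total 1 - phi 1 1"
    by (rule sum_phi_reparam) simp
  finally show ?thesis by simp
qed

section \<open>Roots on the unit circle\<close>

definition Pval :: "'a \<Rightarrow> 'a \<Rightarrow> 'a" where
  "Pval C x = x ^ Q * x + C * x ^ Q + C ^ q * x + 1"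

lemma poly_P_poly: "poly (P_poly q k C) x = Pval C x"
  by (simp add: P_poly_def Pval_def poly_monom mult.commute flip: Q)

definition circle_roots :: "'a \<Rightarrow> 'a set" where "circle_roots C = {x \<in> U. Pval C x = 0}"

lemma U_mult: "x \<in> U \<Longrightarrow> y \<in> U \<Longrightarrow> x * y \<in> U"
  by (simp only: U_def mem_Collect_eq power_mult_distrib mult_1)

text \<open>A root \<open>a\<close> is moved to infinity by \<open>Y = a * (r + 1) / r\<close>: the rest of the unit circle becomes
  the line of elements of trace \<open>1\<close>, and the equation becomes affine over \<open>K\<close>.\<close>

lemma card_circle_roots:
  assumes a: "a \<in> U" "Pval C a = 0"
  defines "Z \<equiv> a ^ Q * a" and "c \<equiv> C * a ^ Q"
  shows "card (circle_roots C) = 1 + card {r. r ^ q + r = 1 \<and> (1 + c) * r ^ Q + (Z + c) * r = Z}"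
proof -
  have X0: "a \<noteq> 0" using a U_nonzero by simp
  have C': "C ^ q * a = Z + c + 1"
  proof -
    have "(Z + c + 1) + C ^ q * a = 0"
      using a(2) by (simp only: Pval_def Z_def c_def ac_simps)
    thus ?thesis by (simp only: add_eq_0)
  qed
  have key: "Pval C (a * (r + 1) / r) = 0 \<longleftrightarrow> (1 + c) * r ^ Q + (Z + c) * r = Z"
    if r: "r \<noteq> 0" for r
  proof -
    define R where "R = r ^ Q"
    have R0: "R \<noteq> 0" using r by (simp add: R_def)
    have YQ: "(a * (r + 1) / r) ^ Q = a ^ Q * (R + 1) / R"
      by (simp add: power_divide power_mult_distrib power_Q_add R_def)
    have "Pval C (a * (r + 1) / r)
        = (a ^ Q * (R + 1) / R) * (a * (r + 1) / r) + C * (a ^ Q * (R + 1) / R)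
            + C ^ q * (a * (r + 1) / r) + 1"
      by (simp only: Pval_def YQ)
    also have "\<dots> * (R * r) = Z * (R + 1) * (r + 1) + c * (R + 1) * r
        + (C ^ q * a) * (r + 1) * R + R * r"
      using r R0 by (simp add: Z_def c_def field_simps)
    \<comment> \<open>The coefficient of \<open>R * r\<close> is
      \<open>Z + c + (Z + c + 1) + 1 = 0\<close>, because \<open>a\<close> is a root; only affine
      terms survive.\<close>
    also have "\<dots> = ((1 + c) * R + (Z + c) * r) + Z"
      unfolding C' by (simp add: algebra_simps)
    finally have "Pval C (a * (r + 1) / r) * (R * r) = ((1 + c) * R + (Z + c) * r) + Z" .
    thus ?thesis using r R0 by (metis R_def add_eq_0 mult_eq_0_iff)
  qed
  have "card {r. r ^ q + r = 1 \<and> (1 + c) * r ^ Q + (Z + c) * r = Z} = card (circle_roots C - {a})"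
  proof (rule bij_betw_same_card[of "\<lambda>r. a * (r + 1) / r"],
      rule bij_betw_byWitness[of _ "\<lambda>Y. a / (a + Y)"], goal_cases)
    case 1
    have "a / (a + a * (r + 1) / r) = r" if "r ^ q + r = 1" for r
    proof -
      have "r \<noteq> 0" using that q_ge2 by (auto simp: power_0_left)
      moreover from this have "a + a * (r + 1) / r = a / r"
        by (simp add: field_simps)
      ultimately show ?thesis using X0 by simp
    qed
    thus ?case by blast
  next
    case 2
    have "a * (a / (a + Y) + 1) / (a / (a + Y)) = Y" if "Y \<noteq> a" for Y
    proof -
      have "a / (a + Y) + 1 = Y / (a + Y)"
        using that by (simp add: divide_plus_one)
      thus ?thesis using X0 that by simp
    qed
    thus ?case by blast
  next
    case 3
    have "a * (r + 1) / r \<in> circle_roots C - {a}"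
      if r: "r ^ q + r = 1" "(1 + c) * r ^ Q + (Z + c) * r = Z" for r
    proof -
      have r0: "r \<noteq> 0" using r q_ge2 by (auto simp: power_0_left)
      \<comment> \<open>Trace 1 makes \<open>(r + 1) / r\<close> a quotient of conjugate elements,
        which has norm 1.\<close>
      have "r + 1 = r ^ q" using r(1) by (metis add.commute add_self_left)
      moreover have "r ^ q / r \<in> U"
        using r0 by (simp add: U_def power_divide power_add)
      ultimately have "a * (r + 1) / r \<in> U"
        using a U_mult by (metis times_divide_eq_right)
      moreover have "a * (r + 1) / r \<noteq> a"
        using X0 r0 by (simp add: field_simps)
      ultimately show ?thesis
        using key[OF r0] r(2) by (simp add: circle_roots_def)
    qed
    thus ?case by (simp only: image_subset_iff mem_Collect_eq) simp
  next
    case 4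
    have "(a / (a + Y)) ^ q + a / (a + Y) = 1 \<and>
      (1 + c) * (a / (a + Y)) ^ Q + (Z + c) * (a / (a + Y)) = Z"
      if Y: "Y \<in> U" "Pval C Y = 0" "Y \<noteq> a" for Y
    proof
      have Y0: "Y \<noteq> 0" using Y U_nonzero by simp
      have XY: "a + Y \<noteq> 0" using Y by auto
      have "a / (a + Y) + 1 = Y / (a + Y)"
        using XY by (simp add: divide_plus_one)
      hence e: "a * (a / (a + Y) + 1) / (a / (a + Y)) = Y" using X0 XY by simp
      have "(a / (a + Y)) ^ q = inverse a / (inverse a + inverse Y)"
        using a Y by (simp add: power_divide power_q_add U_power_q)
      also have "inverse a + inverse Y = (a + Y) / (a * Y)"
        using X0 Y0 by (simp add: field_simps)
      also have "inverse a / ((a + Y) / (a * Y)) = Y / (a + Y)"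
        using X0 Y0 by (simp add: field_simps)
      finally show "(a / (a + Y)) ^ q + a / (a + Y) = 1"
        using XY by (simp add: add.commute flip: add_divide_distrib)
      show "(1 + c) * (a / (a + Y)) ^ Q + (Z + c) * (a / (a + Y)) = Z"
        using key[of "a / (a + Y)"] X0 XY Y(2) unfolding e by simp
    qed
    thus ?case by (auto simp: circle_roots_def)
  qed
  moreover have "card (circle_roots C) = Suc (card (circle_roots C - {a}))"
    using a by (intro card.remove) (auto simp: circle_roots_def)
  ultimately show ?thesis by simp
qed

text \<open>The elements of trace 1 form the coset of \<open>K\<close> through
  \<open>\<rho>\<close>, so \<open>r = w + \<rho>\<close> moves the equation to \<open>K\<close> at
  the cost of changing the constant.\<close>

lemma card_trace_one:
  assumes \<rho>: "\<rho> ^ q + \<rho> = 1"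
  shows "card {r. r ^ q + r = 1 \<and> r ^ Q + t * r = B} = psi t (B + \<rho> ^ Q + t * \<rho>)"
  unfolding psi_def
proof (rule bij_betw_same_card[of "\<lambda>r. r + \<rho>"], rule bij_betw_byWitness[of _ "\<lambda>r. r + \<rho>"], goal_cases)
  case 3
  have "(r + \<rho>) ^ q = r + \<rho>" if "r ^ q + r = 1" for r
  proof -
    have "(r ^ q + r) + (\<rho> ^ q + \<rho>) = 0" using that \<rho> by simp
    hence "(r + \<rho>) ^ q + (r + \<rho>) = 0" by (simp only: power_q_add ac_simps)
    thus ?thesis by (simp only: add_eq_0)
  qed
  thus ?case by (auto simp: K_def power_Q_add algebra_simps)
next
  case 4
  have "(w + \<rho>) ^ q + (w + \<rho>) = 1" if "w ^ q = w" for w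
  proof -
    have "(w + \<rho>) ^ q + (w + \<rho>) = (w ^ q + w) + (\<rho> ^ q + \<rho>)"
      by (simp only: power_q_add ac_simps)
    thus ?thesis using that \<rho> by simp
  qed
  moreover have "(w + \<rho>) ^ Q + t * (w + \<rho>) = B" if "w ^ Q + t * w = B + \<rho> ^ Q + t * \<rho>" for w
  proof -
    have "(w + \<rho>) ^ Q + t * (w + \<rho>) = (w ^ Q + t * w) + (\<rho> ^ Q + t * \<rho>)"
      by (simp add: power_Q_add algebra_simps)
    also have "\<dots> = (B + (\<rho> ^ Q + t * \<rho>)) + (\<rho> ^ Q + t * \<rho>)"
      by (simp only: that add.assoc)
    finally show ?thesis by (simp only: add_self_right)
  qed
  ultimately show ?case by (auto simp: K_def)
qed (auto simp: add.assoc)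

lemma trace_one_in_K:
  assumes "\<rho> ^ q + \<rho> = 1"
  shows "\<rho> ^ Q + \<rho> \<in> K"
proof -
  have e: "\<rho> ^ q = \<rho> + 1" using assms by (metis add.commute add_self_left)
  show ?thesis by (simp add: K_def power_q_add power_q_Q e power_Q_add)
qed

text \<open>The share of the root \<open>a\<close> in the weighted count of all pairs of a root and
  a coefficient.\<close>

definition root_sum :: "'a \<Rightarrow> real" where
  "root_sum a = (\<Sum>C | Pval C a = 0. 1 / real (card (circle_roots C)))"

text \<open>Written in terms of \<open>C * a ^ Q\<close> and its conjugate, the condition on
  \<open>C\<close> becomes visibly affine over \<open>K\<close>.\<close>

lemma Pval_circle:
  assumes "a \<in> U"
  shows "Pval C a = a ^ Q * a + C * a ^ Q + a ^ Q * a * (C * a ^ Q) ^ q + 1"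
proof -
  have "a * a ^ q = 1" "a ^ Q * (a ^ Q) ^ q = 1"
    using assms U_nonzero[of a] by (simp_all add: U_power_q power_q_Q power_mult_distrib[symmetric])
  hence "a ^ Q * a * (C * a ^ Q) ^ q = C ^ q * a"
    by (simp add: power_mult_distrib ac_simps)
  thus ?thesis by (simp only: Pval_def)
qed

lemma circle_add_one_power_q:
  assumes "Z \<in> U"
  shows "(Z + 1) ^ q = (Z + 1) / Z"
  using assms U_nonzero[OF assms] by (simp add: power_q_add U_power_q field_simps)

lemma trace_circle:
  assumes "Z \<in> U" "Z \<noteq> 1"
  shows "(Z / (Z + 1)) ^ q + Z / (Z + 1) = 1"
proof -
  have nz: "Z \<noteq> 0" "Z + 1 \<noteq> 0" using assms U_nonzero by auto
  have "(Z / (Z + 1)) ^ q = 1 / (Z + 1)"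
    using assms nz by (simp add: power_divide circle_add_one_power_q U_power_q)
  thus ?thesis
    using nz by (simp add: add.commute flip: add_divide_distrib)
qed

lemma U_power_Q_mult:
  assumes "a \<in> U"
  shows "a ^ Q * a \<in> U"
proof -
  have "(a ^ Q * a) ^ (q + 1) = (a ^ (q + 1)) ^ Q * a ^ (q + 1)"
    by (simp only: power_mult_distrib mult.commute[of Q] flip: power_mult)
  thus ?thesis using assms by (simp only: U_def mem_Collect_eq power_one mult_1)
qed

text \<open>The coefficients with root \<open>a\<close> are parametrised by \<open>s\<close> in
  \<open>K\<close>. Dividing the affine equation by \<open>1 + s\<close> gives
  \<open>t = s / (s + 1)\<close> with a constant \<open>A\<close> free of \<open>s\<close>; the
  value \<open>s = 1\<close> is treated apart.\<close>

lemma root_sum_generic: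
  assumes a: "a \<in> U" and Z1: "a ^ Q * a \<noteq> 1"
  defines "\<rho> \<equiv> a ^ Q * a / (a ^ Q * a + 1)"
  defines "A \<equiv> \<rho> ^ Q + \<rho>"
  shows "root_sum a = 1 + total A - phi 1 A"
proof -
  define Z where "Z = a ^ Q * a"
  \<comment> \<open>\<open>c s\<close> is the value of \<open>C * a ^ Q\<close>: a particular
    solution \<open>Z\<close> plus the \<open>K\<close>-multiples of \<open>Z + 1\<close>, which
    solve the homogeneous condition.\<close>
  define c where "c s = Z + s * (Z + 1)" for s
  have a0: "a \<noteq> 0" using a U_nonzero by simp
  have ZU: "Z \<in> U" unfolding Z_def using a by (rule U_power_Q_mult)
  have nz: "Z \<noteq> 0" "Z + 1 \<noteq> 0" using U_nonzero[OF ZU] Z1 by (simp_all add: Z_def)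
  have \<rho>: "\<rho> = Z / (Z + 1)" "\<rho> ^ q + \<rho> = 1"
    using trace_circle[OF ZU] Z1 by (simp_all add: \<rho>_def Z_def)
  have AK: "A \<in> K" unfolding A_def using trace_one_in_K \<rho> by simp
  have Pc: "Pval C a = Z + C * a ^ Q + Z * (C * a ^ Q) ^ q + 1" for C
    using Pval_circle[OF a] by (simp add: Z_def)
  have c_q: "Z * c s ^ q = 1 + s ^ q * (Z + 1)" for s
    using nz ZU by (simp add: c_def power_q_add power_mult_distrib circle_add_one_power_q U_power_q field_simps)
  have inv1: "Pval (c s / a ^ Q) a = 0" if "s \<in> K" for s
  proof -
    have "Pval (c s / a ^ Q) a = Z + c s + Z * c s ^ q + 1"
      using a0 by (simp add: Pc)
    also have "\<dots> = 0"
      using that unfolding c_q by (simp add: c_def K_def ac_simps)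
    finally show ?thesis .
  qed
  have inv2: "(C * a ^ Q + Z) / (Z + 1) \<in> K" if "Pval C a = 0" for C
  proof -
    define d where "d = C * a ^ Q"
    have "(Z * d ^ q + 1) + (Z + d) = 0"
      using that unfolding Pc d_def by (simp only: ac_simps)
    hence e: "Z * d ^ q + 1 = Z + d" by (simp only: add_eq_0)
    have "((d + Z) / (Z + 1)) ^ q = (d ^ q + 1 / Z) / ((Z + 1) / Z)"
      unfolding power_divide circle_add_one_power_q[OF ZU]
      using ZU by (simp add: power_q_add U_power_q inverse_eq_divide)
    also have "\<dots> = (Z * d ^ q + 1) / (Z + 1)"
      using nz by (simp add: field_simps)
    finally show ?thesis unfolding e by (simp add: K_def d_def add.commute)
  qed
  have cnt: "card (circle_roots (c s / a ^ Q))
      = 1 + card {r. r ^ q + r = 1 \<and> (1 + s) * r ^ Q + s * r = \<rho>}" if "s \<in> K" for s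
  proof -
    have "c s / a ^ Q * a ^ Q = c s" using a0 by simp
    moreover have "1 + c s = (1 + s) * (Z + 1)" "Z + c s = s * (Z + 1)"
      by (simp_all add: c_def algebra_simps)
    moreover have "(1 + s) * (Z + 1) * r ^ Q + s * (Z + 1) * r = Z
        \<longleftrightarrow> (1 + s) * r ^ Q + s * r = \<rho>" for r
    proof -
      have "(1 + s) * (Z + 1) * r ^ Q + s * (Z + 1) * r = ((1 + s) * r ^ Q + s * r) * (Z + 1)"
        by (simp add: algebra_simps)
      thus ?thesis using nz(2) by (simp only: \<rho>(1) eq_divide_eq) simp
    qed
    ultimately show ?thesis
      using card_circle_roots[OF a inv1[OF that]] unfolding Z_def[symmetric] by (simp only:)
  qed
  \<comment> \<open>At \<open>s = 1\<close> the leading coefficient vanishes, so there is one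
    further root and the weight is \<open>1 / 2\<close>.\<close>
  have cnt_1: "card {r. r ^ q + r = 1 \<and> (1 + 1) * r ^ Q + 1 * r = \<rho>} = 1"
  proof -
    have "{r. r ^ q + r = 1 \<and> (1 + 1) * r ^ Q + 1 * r = \<rho>} = {\<rho>}"
      using \<rho>(2) by auto
    thus ?thesis by simp
  qed
  have cnt_s: "card {r. r ^ q + r = 1 \<and> (1 + s) * r ^ Q + s * r = \<rho>} = psi (s / (s + 1)) A"
    if "s \<noteq> 1" for s
  proof -
    have nz: "1 + s \<noteq> 0" using that by auto
    have "(1 + s) * r ^ Q + s * r = \<rho> \<longleftrightarrow> r ^ Q + s / (s + 1) * r = \<rho> / (1 + s)" for r
      using nz by (simp add: field_simps)
    hence "card {r. r ^ q + r = 1 \<and> (1 + s) * r ^ Q + s * r = \<rho>}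
        = psi (s / (s + 1)) (\<rho> / (1 + s) + \<rho> ^ Q + s / (s + 1) * \<rho>)"
      by (simp only: card_trace_one[OF \<rho>(2)])
    also have "\<rho> / (1 + s) + \<rho> ^ Q + s / (s + 1) * \<rho> = \<rho> ^ Q + (1 + s) / (1 + s) * \<rho>"
      unfolding add_divide_distrib by (simp add: algebra_simps)
    also have "\<dots> = A" using nz by (simp add: A_def)
    finally show ?thesis .
  qed
  have "root_sum a = (\<Sum>s\<in>K. 1 / real (card (circle_roots (c s / a ^ Q))))"
    unfolding root_sum_def
    by (rule sum.reindex_bij_witness[of _ "\<lambda>s. c s / a ^ Q" "\<lambda>C. (C * a ^ Q + Z) / (Z + 1)"])
       (use a0 nz inv1 inv2 in \<open>auto simp: c_def ac_simps\<close>)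
  also have "\<dots> = 1 / 2 + (\<Sum>s\<in>K - {1}. 1 / real (card (circle_roots (c s / a ^ Q))))"
    by (subst sum.remove[of _ 1]) (simp_all add: cnt cnt_1[simplified])
  also have "(\<Sum>s\<in>K - {1}. 1 / real (card (circle_roots (c s / a ^ Q))))
      = (\<Sum>s\<in>K - {1}. phi (s / (s + 1)) A)"
    by (intro sum.cong) (auto simp: cnt cnt_s phi_def)
  also have "\<dots> = 1 / 2 + total A - phi 1 A"
    using AK by (rule sum_phi_reparam)
  finally show ?thesis by simp
qed

text \<open>Here \<open>C * a ^ Q\<close> ranges over \<open>K\<close> and \<open>t = 1\<close>
  throughout, while the constant \<open>1 / (s + 1) + A\<close> takes every value in
  \<open>K\<close> except \<open>A\<close>. At \<open>s = 1\<close> the equation reads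
  \<open>0 = 1\<close>, so \<open>a\<close> is the only root and has weight 1.\<close>

lemma root_sum_special:
  assumes a: "a \<in> U" and Z1: "a ^ Q * a = 1" and \<rho>: "\<rho> ^ q + \<rho> = 1"
  defines "A \<equiv> \<rho> ^ Q + \<rho>"
  shows "root_sum a = 1 + (real q - real q / (1 + real del)) - phi 1 A"
proof -
  have a0: "a \<noteq> 0" using a U_nonzero by simp
  have AK: "A \<in> K" unfolding A_def using \<rho> by (rule trace_one_in_K)
  have Pc: "Pval C a = 0 \<longleftrightarrow> C * a ^ Q \<in> K" for C
    using Pval_circle[OF a, of C] Z1 by (auto simp: K_def add.commute)
  have cnt: "card (circle_roots (s / a ^ Q))
      = 1 + card {r. r ^ q + r = 1 \<and> (1 + s) * r ^ Q + (1 + s) * r = 1}" if "s \<in> K" for s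
    using card_circle_roots[OF a, of "s / a ^ Q"] a0 that by (simp add: Pc Z1)
  have cnt_s: "card {r. r ^ q + r = 1 \<and> (1 + s) * r ^ Q + (1 + s) * r = 1} = psi 1 (1 / (s + 1) + A)"
    if "s \<noteq> 1" for s
  proof -
    have nz: "1 + s \<noteq> 0" using that by auto
    have "(1 + s) * r ^ Q + (1 + s) * r = 1 \<longleftrightarrow> r ^ Q + 1 * r = 1 / (s + 1)" for r
      using nz by (simp add: field_simps)
    hence "card {r. r ^ q + r = 1 \<and> (1 + s) * r ^ Q + (1 + s) * r = 1}
        = psi 1 (1 / (s + 1) + \<rho> ^ Q + 1 * \<rho>)"
      by (simp only: card_trace_one[OF \<rho>])
    thus ?thesis by (simp add: A_def add.assoc)
  qed
  have "root_sum a = (\<Sum>s\<in>K. 1 / real (card (circle_roots (s / a ^ Q))))"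
    unfolding root_sum_def
    by (rule sum.reindex_bij_witness[of _ "\<lambda>s. s / a ^ Q" "\<lambda>C. C * a ^ Q"])
       (use a0 Pc in auto)
  also have "\<dots> = 1 + (\<Sum>s\<in>K - {1}. 1 / real (card (circle_roots (s / a ^ Q))))"
    by (subst sum.remove[of _ 1]) (simp_all add: cnt)
  also have "(\<Sum>s\<in>K - {1}. 1 / real (card (circle_roots (s / a ^ Q))))
      = (\<Sum>s\<in>K - {1}. phi 1 (1 / (s + 1) + A))"
    by (intro sum.cong) (auto simp: cnt cnt_s phi_def)
  also have "\<dots> = (\<Sum>B\<in>K - {A}. phi 1 B)"
    by (rule sum.reindex_bij_witness[of _ "\<lambda>B. 1 / (B + A) + 1" "\<lambda>s. 1 / (s + 1) + A"])
       (use AK in auto)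
  also have "\<dots> = (\<Sum>B\<in>K. phi 1 B) - phi 1 A"
    using AK by (simp add: sum_diff1)
  also have "(\<Sum>B\<in>K. phi 1 B) = real q - real q / (1 + real del)"
    by (simp add: sum_phi_K psi_1_0)
  finally show ?thesis by simp
qed

lemma card_C_with_root:
  "real (card {C. \<exists>a\<in>U. Pval C a = 0}) = (\<Sum>a\<in>U. root_sum a)"
proof -
  define R where "R = Sigma U (\<lambda>a. {C. Pval C a = 0})"
  have img: "{C. \<exists>a\<in>U. Pval C a = 0} = snd ` R"
    by (force simp: R_def)
  have fib: "card {p \<in> R. snd p = C} = card (circle_roots C)" for C
    by (rule bij_betw_same_card[of fst], rule bij_betw_byWitness[of _ "\<lambda>a. (a, C)"])
       (auto simp: R_def circle_roots_def)
  have "real (card {C. \<exists>a\<in>U. Pval C a = 0}) = (\<Sum>p\<in>R. 1 / real (card (circle_roots (snd p))))"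
    unfolding img by (subst card_image_eq_sum_inverse_fibers) (simp_all add: fib)
  also have "\<dots> = (\<Sum>a\<in>U. root_sum a)"
    unfolding R_def root_sum_def by (subst sum.Sigma) (auto intro!: sum.cong)
  finally show ?thesis .
qed

section \<open>Parity conditions\<close>

lemma two_power_shift:
  assumes "(x::'a) ^ (2 ^ i) = x + 1"
  shows "x ^ (2 ^ (i * j)) = (if even j then x else x + 1)"
proof (induction j)
  case (Suc j)
  have "x ^ (2 ^ (i * Suc j)) = (x ^ (2 ^ (i * j))) ^ (2 ^ i)"
    by (simp add: power_add mult.commute flip: power_mult)
  thus ?case using Suc assms by (simp add: power_two_power_add)
qed simp

lemma two_power_fixed:
  assumes "(x::'a) ^ (2 ^ i) = x"
  shows "x ^ (2 ^ (i * j)) = x"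
proof (induction j)
  case (Suc j)
  have "x ^ (2 ^ (i * Suc j)) = (x ^ (2 ^ (i * j))) ^ (2 ^ i)"
    by (simp add: power_add mult.commute flip: power_mult)
  thus ?case using Suc assms by simp
qed simp

text \<open>At this exponent, \<open>lcm k m\<close>, iterates of the \<open>Q\<close>-Frobenius and
  of the \<open>q\<close>-Frobenius coincide; contradictions arise when one fixes an element and the
  other adds 1.\<close>

lemma k_m_cross: "k * (m div gcd k m) = m * (k div gcd k m)"
  by (metis div_mult_swap gcd_dvd1 gcd_dvd2 mult.commute)

lemma no_trace_one_fixed:
  assumes "odd (k div gcd k m)" "(x::'a) ^ q + x = 1"
  shows "x ^ Q \<noteq> x"
proof
  assume "x ^ Q = x"
  hence "x ^ (2 ^ (k * (m div gcd k m))) = x"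
    unfolding Q by (rule two_power_fixed)
  moreover have "x ^ q = x + 1" using assms(2) by (metis add.commute add_self_left)
  hence "x ^ (2 ^ (m * (k div gcd k m))) = x + 1"
    unfolding q using assms(1) by (simp add: two_power_shift)
  ultimately show False unfolding k_m_cross by simp
qed

lemma psi_1_1_odd:
  assumes "odd (m div gcd k m)"
  shows "psi 1 1 = 0"
proof -
  have False if w: "w \<in> K" "w ^ Q + w = 1" for w
  proof -
    have "w ^ Q = w + 1" using w(2) by (metis add.commute add_self_left)
    hence "w ^ (2 ^ (k * (m div gcd k m))) = w + 1"
      unfolding Q using assms(1) by (simp add: two_power_shift)
    moreover have "w ^ (2 ^ (m * (k div gcd k m))) = w"
      using w(1) by (intro two_power_fixed) (simp add: K_def flip: q)
    ultimately show False unfolding k_m_cross by simp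
  qed
  hence "{w \<in> K. w ^ Q + 1 * w = 1} = {}" by auto
  thus ?thesis by (simp add: psi_def)
qed

text \<open>The elements below are those of the subfield of order \<open>del ^ 2\<close>; they cannot all lie in the
  intersection of \<open>K\<close> with the fixed field of the \<open>Q\<close>-Frobenius, which has order \<open>del\<close>.\<close>

lemma exists_moved:
  obtains x :: 'a where "x ^ (2 ^ (2 * gcd k m) - 1) = 1" "x ^ Q \<noteq> x \<or> x ^ q \<noteq> x"
proof -
  have *: "x ^ (j - 1) = 1" if "x ^ j = x" "x \<noteq> 0" "j > 0" for x :: 'a and j
    using that by (metis Suc_pred' mult_cancel_left2 power_Suc)
  define S where "S = {x::'a. x ^ (2 ^ (2 * gcd k m) - 1) = 1}"
  have CC: "CARD('a) - 1 = 2 ^ (2 * m) - 1"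
    by (simp add: card_field q mult.commute flip: power_mult)
  have "card S = 2 ^ (2 * gcd k m) - 1"
    unfolding S_def
  proof (rule card_roots_of_unity_finite_field)
    have "gcd (2 ^ (2 * gcd k m) - 1) (2 ^ (2 * m) - 1 :: nat) = 2 ^ (2 * gcd k m) - 1"
      unfolding gcd_two_power_minus_one by (simp add: gcd_nat.absorb1)
    thus "2 ^ (2 * gcd k m) - 1 dvd CARD('a) - 1"
      unfolding CC by (metis gcd_dvd2)
  qed
  moreover have "card {x::'a. x ^ (del - 1) = 1} = del - 1"
    by (rule card_roots_of_unity_finite_field)
       (simp only: q_square_minus_one dvd_mult2 gcd_dvd2 flip: gcd_Q_q_minus_one)
  moreover have "del - 1 < 2 ^ (2 * gcd k m) - 1"
  proof -
    have "del < del * del" using del_ge2 by simp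
    moreover have "del * del = 2 ^ (2 * gcd k m)"
      by (simp add: del_def mult_2 power_add)
    ultimately show ?thesis using del_ge2 by linarith
  qed
  ultimately have "\<not> S \<subseteq> {x. x ^ (del - 1) = 1}"
    by (metis card_mono finite not_le)
  then obtain x where x: "x \<in> S" "x ^ (del - 1) \<noteq> 1" by auto
  have x0: "x \<noteq> 0"
  proof
    assume "x = 0"
    moreover have "2 ^ (2 * gcd k m) - 1 \<noteq> (0::nat)"
      using \<open>del - 1 < 2 ^ (2 * gcd k m) - 1\<close> by linarith
    ultimately show False using x(1) by (simp add: S_def power_0_left)
  qed
  have "x ^ Q \<noteq> x \<or> x ^ q \<noteq> x"
  proof (rule ccontr)
    assume "\<not> ?thesis"
    hence "x ^ (Q - 1) = 1" "x ^ (q - 1) = 1"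
      using *[of x] x0 Q_ge2 q_ge2 by auto
    hence "x ^ gcd (Q - 1) (q - 1) = 1" by (rule power_gcd_eq_one)
    thus False using x(2) by (simp only: gcd_Q_q_minus_one)
  qed
  thus ?thesis using that x(1) by (auto simp: S_def)
qed

lemma fixed_if_dvd:
  assumes "(x::'a) ^ (2 ^ i - 1) = 1" "i dvd j"
  shows "x ^ (2 ^ j) = x"
proof -
  have "x ^ (2 ^ i) = x * x ^ (2 ^ i - 1)"
    by (simp flip: power_Suc)
  hence "x ^ (2 ^ i) = x" using assms(1) by simp
  thus ?thesis using assms(2) two_power_fixed by (metis dvdE)
qed

text \<open>The moved element \<open>x\<close> is fixed by the \<open>Q\<close>-Frobenius since
  \<open>2 * gcd k m\<close> divides \<open>k\<close>, so its trace is nonzero; dividing by the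
  trace, which is also fixed, normalises it to 1.\<close>

lemma exists_trace_one_fixed:
  assumes "even (k div gcd k m)"
  obtains x :: 'a where "x ^ q + x = 1" "x ^ Q = x"
proof -
  obtain x :: 'a where x: "x ^ (2 ^ (2 * gcd k m) - 1) = 1" "x ^ Q \<noteq> x \<or> x ^ q \<noteq> x"
    using exists_moved .
  have "2 * gcd k m dvd k"
    using assms by (metis dvd_div_iff_mult gcd_dvd1 gcd_eq_0_iff k mult.commute not_one_le_zero)
  hence xQ: "x ^ Q = x" unfolding Q using x(1) by (intro fixed_if_dvd)
  define y where "y = x ^ q + x"
  have y: "y \<noteq> 0" "y ^ q = y" "y ^ Q = y"
    using x(2) xQ by (auto simp: y_def power_q_add power_Q_add add.commute power_q_Q[symmetric])
  have "(x / y) ^ q + x / y = 1"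
    using y by (simp add: power_divide flip: add_divide_distrib) (simp add: y_def)
  moreover have "(x / y) ^ Q = x / y"
    using y xQ by (simp add: power_divide)
  ultimately show ?thesis using that by blast
qed

text \<open>The roles of the two Frobenius maps are exchanged: \<open>x\<close> lies in
  \<open>K\<close>, and \<open>x ^ Q + x\<close> is a nonzero element fixed by both, so dividing by
  it gives a solution.\<close>

lemma psi_1_1_even:
  assumes "even (m div gcd k m)"
  shows "psi 1 1 = del"
proof -
  obtain x :: 'a where x: "x ^ (2 ^ (2 * gcd k m) - 1) = 1" "x ^ Q \<noteq> x \<or> x ^ q \<noteq> x"
    using exists_moved .
  have "2 * gcd k m dvd m"
    using assms by (metis dvd_div_iff_mult gcd_dvd2 gcd_eq_0_iff k mult.commute not_one_le_zero)
  hence xq: "x ^ q = x" unfolding q using x(1) by (intro fixed_if_dvd)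
  have "x ^ (2 ^ (2 * k)) = x" using x(1) by (intro fixed_if_dvd) auto
  hence xQQ: "(x ^ Q) ^ Q = x" by (simp add: Q mult_2 power_add flip: power_mult)
  define y where "y = x ^ Q + x"
  have y: "y \<noteq> 0" "y ^ q = y" "y ^ Q = y"
    using x(2) xq xQQ by (auto simp: y_def power_q_add power_Q_add add.commute power_q_Q)
  have "(x / y) ^ Q + x / y = 1"
    using y by (simp add: power_divide flip: add_divide_distrib) (simp add: y_def)
  moreover have "x / y \<in> K"
    using y xq by (simp add: K_def power_divide)
  ultimately have "{w \<in> K. w ^ Q + 1 * w = 1} \<noteq> {}" by auto
  hence "psi 1 1 \<noteq> 0"
    unfolding psi_def by (metis card_eq_0_iff finite)
  thus ?thesis using psi_cases[of 1 1] psi_1_0 by simp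
qed

lemma card_special: "card {a \<in> U. a ^ Q * a = 1} = gcd (Q + 1) (q + 1)"
proof -
  have "{a \<in> U. a ^ Q * a = 1} = {a. a ^ (Q + 1) = 1 \<and> a ^ (q + 1) = 1}"
    by (auto simp: U_def mult.commute)
  also have "\<dots> = {a. a ^ gcd (Q + 1) (q + 1) = 1}"
    by (simp only: power_eq_one_iff_gcd)
  also have "card \<dots> = gcd (Q + 1) (q + 1)"
    by (rule card_roots_of_unity_finite_field) (simp only: q_square_minus_one dvd_mult gcd_dvd2)
  finally show ?thesis .
qed

lemma gcd_Q_q: "gcd (Q + 1) (q + 1)
    = (if odd (k div gcd k m) \<and> odd (m div gcd k m) then del + 1 else 1)"
  using gcd_two_power_plus_one[of k m] k unfolding q Q del_def by simp

lemma gcd_Q_minus_q: "gcd (Q - 1) (q + 1) = (if even (k div gcd k m) then del + 1 else 1)"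
  using gcd_two_power_minus_plus_one[of k m] k m unfolding q Q del_def by simp

lemma odd_m_div: "even (k div gcd k m) \<Longrightarrow> odd (m div gcd k m)"
  using not_both_even_div_gcd[of k m] k by simp

lemma phi_1_1: "phi 1 1 = (if odd (m div gcd k m) then 1 else 1 / (1 + real del))"
  using psi_1_1_odd psi_1_1_even by (simp add: phi_def)

text \<open>Solvability of \<open>w ^ Q + w = \<rho> ^ Q + \<rho>\<close> in \<open>K\<close>
  amounts to the existence of an element of trace 1 fixed by the \<open>Q\<close>-Frobenius, namely
  \<open>w + \<rho>\<close>.\<close>

lemma phi_1_trace_one_odd:
  assumes "odd (k div gcd k m)" "(\<rho>::'a) ^ q + \<rho> = 1"
  shows "phi 1 (\<rho> ^ Q + \<rho>) = 1" "\<rho> ^ Q + \<rho> \<noteq> 0"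
proof -
  have "card {r::'a. r ^ q + r = 1 \<and> r ^ Q + 1 * r = 0} = psi 1 (0 + \<rho> ^ Q + 1 * \<rho>)"
    using assms(2) by (rule card_trace_one)
  moreover have "{r::'a. r ^ q + r = 1 \<and> r ^ Q + 1 * r = 0} = {}"
    using no_trace_one_fixed[OF assms(1)] by auto
  ultimately have "psi 1 (0 + \<rho> ^ Q + 1 * \<rho>) = 0" by (metis card.empty)
  thus "phi 1 (\<rho> ^ Q + \<rho>) = 1" by (simp add: phi_def)
  show "\<rho> ^ Q + \<rho> \<noteq> 0"
    using no_trace_one_fixed[OF assms] by simp
qed

lemma phi_1_trace_one_even:
  assumes "even (k div gcd k m)" "(\<rho>::'a) ^ q + \<rho> = 1"
  shows "phi 1 (\<rho> ^ Q + \<rho>) = 1 / (1 + real del)"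
proof -
  have "card {r::'a. r ^ q + r = 1 \<and> r ^ Q + 1 * r = 0} = psi 1 (0 + \<rho> ^ Q + 1 * \<rho>)"
    using assms(2) by (rule card_trace_one)
  moreover obtain x :: 'a where "x ^ q + x = 1" "x ^ Q = x"
    using exists_trace_one_fixed[OF assms(1)] .
  hence "x \<in> {r::'a. r ^ q + r = 1 \<and> r ^ Q + 1 * r = 0}" by simp
  hence "card {r::'a. r ^ q + r = 1 \<and> r ^ Q + 1 * r = 0} > 0"
    by (subst card_gt_0_iff, intro conjI, blast) simp
  ultimately have "psi 1 (\<rho> ^ Q + \<rho>) \<noteq> 0" by simp
  thus ?thesis
    using psi_cases[of 1 "\<rho> ^ Q + \<rho>"] psi_1_0 by (simp add: phi_def)
qed

lemma exists_trace_one: obtains \<rho> :: 'a where "\<rho> ^ q + \<rho> = 1"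
proof -
  have "\<not> U \<subseteq> {1}"
  proof
    assume "U \<subseteq> {1}"
    hence "card U \<le> card {1::'a}" by (rule card_mono[rotated]) simp
    thus False using q_ge2 by (simp add: card_U)
  qed
  then obtain Z where "Z \<in> U" "Z \<noteq> 1" by auto
  thus ?thesis using trace_circle that by blast
qed

section \<open>The count\<close>

definition A_of :: "'a \<Rightarrow> 'a" where
  "A_of a = (a ^ Q * a / (a ^ Q * a + 1)) ^ Q + a ^ Q * a / (a ^ Q * a + 1)"

lemma sum_root_sum:
  fixes \<rho> :: 'a
  assumes \<rho>: "\<rho> ^ q + \<rho> = 1"
  shows "(\<Sum>a\<in>U. root_sum a) =
    real (gcd (Q + 1) (q + 1)) * (1 + (real q - real q / (1 + real del)) - phi 1 (\<rho> ^ Q + \<rho>))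
    + (\<Sum>a\<in>{a \<in> U. a ^ Q * a \<noteq> 1}. 1 + total (A_of a) - phi 1 (A_of a))"
proof -
  have "(\<Sum>a\<in>U. root_sum a) = (\<Sum>a\<in>{a \<in> U. a ^ Q * a = 1} \<union> {a \<in> U. a ^ Q * a \<noteq> 1}. root_sum a)"
    by (rule sum.cong) auto
  also have "\<dots> = (\<Sum>a\<in>{a \<in> U. a ^ Q * a = 1}. root_sum a) + (\<Sum>a\<in>{a \<in> U. a ^ Q * a \<noteq> 1}. root_sum a)"
    by (rule sum.union_disjoint) auto
  also have "(\<Sum>a\<in>{a \<in> U. a ^ Q * a = 1}. root_sum a)
      = (\<Sum>a\<in>{a \<in> U. a ^ Q * a = 1}. 1 + (real q - real q / (1 + real del)) - phi 1 (\<rho> ^ Q + \<rho>))"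
    using \<rho> by (intro sum.cong refl root_sum_special) auto
  also have "\<dots> = real (gcd (Q + 1) (q + 1)) * (1 + (real q - real q / (1 + real del)) - phi 1 (\<rho> ^ Q + \<rho>))"
    by (simp only: sum_constant card_special)
  also have "(\<Sum>a\<in>{a \<in> U. a ^ Q * a \<noteq> 1}. root_sum a)
      = (\<Sum>a\<in>{a \<in> U. a ^ Q * a \<noteq> 1}. 1 + total (A_of a) - phi 1 (A_of a))"
    unfolding A_of_def by (intro sum.cong refl root_sum_generic) auto
  finally show ?thesis .
qed

lemma card_generic: "real (card {a \<in> U. a ^ Q * a \<noteq> 1}) = real q + 1 - real (gcd (Q + 1) (q + 1))"
proof -
  have "{a \<in> U. a ^ Q * a \<noteq> 1} = U - {a \<in> U. a ^ Q * a = 1}" by auto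
  hence "card {a \<in> U. a ^ Q * a \<noteq> 1} = card U - gcd (Q + 1) (q + 1)"
    by (metis (no_types, lifting) card_Diff_subset card_special finite mem_Collect_eq subsetI)
  moreover have "gcd (Q + 1) (q + 1) \<le> q + 1" by (rule gcd_le2_nat) simp
  ultimately show ?thesis by (simp add: card_U of_nat_diff)
qed

lemma A_of_in_K: "a \<in> U \<Longrightarrow> a ^ Q * a \<noteq> 1 \<Longrightarrow> A_of a \<in> K"
  unfolding A_of_def by (intro trace_one_in_K trace_circle U_power_Q_mult)

lemma trace_A_of: "a \<in> U \<Longrightarrow> a ^ Q * a \<noteq> 1 \<Longrightarrow>
    (a ^ Q * a / (a ^ Q * a + 1)) ^ q + a ^ Q * a / (a ^ Q * a + 1) = 1"
  by (intro trace_circle U_power_Q_mult)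

text \<open>Every constant \<open>A_of a\<close> is nonzero with \<open>phi 1 (A_of a) = 1\<close>,
  so each generic root contributes exactly \<open>total 1\<close>.\<close>

lemma sum_root_sum_odd:
  assumes "odd (k div gcd k m)"
  shows "(\<Sum>a\<in>U. root_sum a) = real (gcd (Q + 1) (q + 1)) * (real q - real q / (1 + real del))
    + (real q + 1 - real (gcd (Q + 1) (q + 1))) * total 1"
proof -
  obtain \<rho> :: 'a where \<rho>: "\<rho> ^ q + \<rho> = 1" using exists_trace_one .
  have "(\<Sum>a\<in>{a \<in> U. a ^ Q * a \<noteq> 1}. 1 + total (A_of a) - phi 1 (A_of a))
      = (\<Sum>a\<in>{a \<in> U. a ^ Q * a \<noteq> 1}. total 1)"
  proof (intro sum.cong refl)
    fix a assume "a \<in> {a \<in> U. a ^ Q * a \<noteq> 1}"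
    hence a: "a \<in> U" "a ^ Q * a \<noteq> 1" by auto
    note A = phi_1_trace_one_odd[OF assms trace_A_of[OF a], folded A_of_def]
    have "total (A_of a) = total 1"
      using A_of_in_K[OF a] A(2) by (rule total_eq_total_1)
    thus "1 + total (A_of a) - phi 1 (A_of a) = total 1" using A(1) by simp
  qed
  also have "\<dots> = (real q + 1 - real (gcd (Q + 1) (q + 1))) * total 1"
    by (simp only: sum_constant card_generic)
  finally show ?thesis
    unfolding sum_root_sum[OF \<rho>] phi_1_trace_one_odd(1)[OF assms \<rho>] by simp
qed

text \<open>\<open>A_of a\<close> vanishes when \<open>Z / (Z + 1)\<close> is fixed by the
  \<open>Q\<close>-Frobenius; this fractional linear map is injective, so the condition is
  \<open>Z ^ Q = Z\<close>.\<close>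

lemma A_of_eq_0_iff:
  assumes "a \<in> U" "a ^ Q * a \<noteq> 1"
  shows "A_of a = 0 \<longleftrightarrow> a ^ ((Q + 1) * (Q - 1)) = 1"
proof -
  define Z where "Z = a ^ Q * a"
  have Z: "Z \<noteq> 0" "Z + 1 \<noteq> 0"
    using assms U_nonzero[of a] by (auto simp: Z_def)
  have "A_of a = 0 \<longleftrightarrow> Z ^ Q / (Z ^ Q + 1) = Z / (Z + 1)"
    by (simp add: A_of_def power_divide power_Q_add flip: Z_def)
  also have "\<dots> \<longleftrightarrow> Z ^ Q = Z"
  proof -
    have "Z ^ Q + 1 \<noteq> 0"
      using Z(2) power_Q_inj[of Z 1] by simp
    thus ?thesis using Z by (simp add: field_simps)
  qed
  also have "\<dots> \<longleftrightarrow> Z * Z ^ (Q - 1) = Z * 1"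
    using Q_ge2 by (simp flip: power_Suc)
  also have "\<dots> \<longleftrightarrow> Z ^ (Q - 1) = 1"
    using Z(1) by simp
  also have "Z ^ (Q - 1) = a ^ ((Q + 1) * (Q - 1))"
    by (simp only: Z_def power_mult power_add power_one_right)
  finally show ?thesis .
qed

text \<open>The condition on exponents has \<open>del + 1\<close> solutions on the circle, since
  \<open>Q + 1\<close> is coprime to \<open>q + 1\<close>; the one with \<open>a ^ Q * a = 1\<close>
  is removed.\<close>

lemma card_A_of_eq_0:
  assumes "even (k div gcd k m)"
  shows "card {a \<in> {a \<in> U. a ^ Q * a \<noteq> 1}. A_of a = 0} = del"
proof -
  have G: "gcd (Q + 1) (q + 1) = 1"
    using assms by (simp only: gcd_Q_q) simp
  define S where "S = {a::'a. a ^ ((Q + 1) * (Q - 1)) = 1 \<and> a ^ (q + 1) = 1}"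
  have S: "card S = del + 1"
  proof -
    have "gcd ((Q + 1) * (Q - 1)) (q + 1) = gcd (Q - 1) (q + 1)"
      using G by (intro gcd_mult_left_left_cancel) (simp only: coprime_iff_gcd_eq_1 gcd.commute)
    also have "\<dots> = del + 1" using assms by (simp only: gcd_Q_minus_q if_True)
    finally have g: "gcd ((Q + 1) * (Q - 1)) (q + 1) = del + 1" .
    have "S = {a. a ^ gcd ((Q + 1) * (Q - 1)) (q + 1) = 1}"
      unfolding S_def by (simp only: power_eq_one_iff_gcd)
    also have "card \<dots> = gcd ((Q + 1) * (Q - 1)) (q + 1)"
      by (rule card_roots_of_unity_finite_field) (simp only: q_square_minus_one dvd_mult gcd_dvd2)
    finally show ?thesis unfolding g .
  qed
  have sub: "{a \<in> U. a ^ Q * a = 1} \<subseteq> S"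
  proof
    fix a assume "a \<in> {a \<in> U. a ^ Q * a = 1}"
    hence "a ^ (Q + 1) = 1" "a ^ (q + 1) = 1" by (simp_all add: U_def mult.commute)
    thus "a \<in> S" by (simp only: S_def mem_Collect_eq power_mult power_one simp_thms)
  qed
  have "{a \<in> {a \<in> U. a ^ Q * a \<noteq> 1}. A_of a = 0} = S - {a \<in> U. a ^ Q * a = 1}"
    using A_of_eq_0_iff unfolding S_def U_def by blast
  hence "card {a \<in> {a \<in> U. a ^ Q * a \<noteq> 1}. A_of a = 0} = card S - card {a \<in> U. a ^ Q * a = 1}"
    using card_Diff_subset[OF finite sub] by (simp only:)
  thus ?thesis unfolding S card_special G by simp
qed

text \<open>There is one special root and there are \<open>q\<close> generic ones, of which
  \<open>del\<close> have \<open>A_of a = 0\<close> and contribute through \<open>total 0\<close>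
  instead of \<open>total 1\<close>.\<close>

lemma sum_root_sum_even:
  assumes "even (k div gcd k m)"
  shows "(\<Sum>a\<in>U. root_sum a) = 1 + (real q - real q / (1 + real del)) - 1 / (1 + real del)
    + real q * (1 - 1 / (1 + real del)) + real del * total 0 + (real q - real del) * total 1"
proof -
  obtain \<rho> :: 'a where \<rho>: "\<rho> ^ q + \<rho> = 1" using exists_trace_one .
  have G: "gcd (Q + 1) (q + 1) = 1"
    using assms by (simp only: gcd_Q_q) simp
  let ?V = "{a \<in> U. a ^ Q * a \<noteq> 1}"
  have V: "real (card ?V) = real q" using card_generic unfolding G by simp
  have "(\<Sum>a\<in>?V. 1 + total (A_of a) - phi 1 (A_of a))
      = (\<Sum>a\<in>?V. (1 - 1 / (1 + real del)) + total (A_of a))"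
  proof (intro sum.cong refl)
    fix a assume "a \<in> ?V"
    hence a: "a \<in> U" "a ^ Q * a \<noteq> 1" by auto
    show "1 + total (A_of a) - phi 1 (A_of a) = (1 - 1 / (1 + real del)) + total (A_of a)"
      using phi_1_trace_one_even[OF assms trace_A_of[OF a], folded A_of_def] by simp
  qed
  also have "\<dots> = real q * (1 - 1 / (1 + real del)) + (\<Sum>a\<in>?V. total (A_of a))"
    by (simp only: sum.distrib sum_constant V)
  also have "(\<Sum>a\<in>?V. total (A_of a)) = (\<Sum>a\<in>?V. total 1 + (if A_of a = 0 then total 0 - total 1 else 0))"
    using A_of_in_K by (intro sum.cong refl) (auto intro: total_eq_total_1)
  also have "\<dots> = real q * total 1 + (\<Sum>a\<in>{a \<in> ?V. A_of a = 0}. total 0 - total 1)"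
    by (simp only: sum.distrib sum_constant V) (simp add: sum.If_cases Int_def)
  also have "\<dots> = real q * total 1 + real del * (total 0 - total 1)"
    by (simp only: sum_constant card_A_of_eq_0[OF assms])
  finally show ?thesis
    unfolding sum_root_sum[OF \<rho>] phi_1_trace_one_even[OF assms \<rho>] G by (simp add: algebra_simps)
qed

lemma card_no_root:
  "real (card {C. \<not> (\<exists>a\<in>U. Pval C a = 0)}) = real q ^ 2 - (\<Sum>a\<in>U. root_sum a)"
proof -
  have "{C. \<not> (\<exists>a\<in>U. Pval C a = 0)} = UNIV - {C. \<exists>a\<in>U. Pval C a = 0}" by auto
  hence "card {C. \<not> (\<exists>a\<in>U. Pval C a = 0)} = CARD('a) - card {C. \<exists>a\<in>U. Pval C a = 0}"
    by (simp add: card_Diff_subset)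
  moreover have "card {C. \<exists>a\<in>U. Pval C a = 0} \<le> CARD('a)"
    by (rule card_mono) auto
  ultimately show ?thesis
    by (simp add: of_nat_diff card_field card_C_with_root[symmetric])
qed

lemma count_formula:
  defines "N \<equiv> real (card {C. \<not> (\<exists>a\<in>U. Pval C a = 0)})"
  shows "N = (real q - real (gcd (Q + 1) (q + 1)) + 1) * (real q - real (card (Gamma_map k ` K)) - 1)
      + (real q + 1) / real (gcd (Q - 1) (q + 1)) - real (gcd (Q + 1) (q + 1))"
proof -
  \<comment> \<open>With the rule \<open>d * i = 1 - i\<close>, the three possible parity cases
    reduce to polynomial identities.\<close>
  define x d i where "x = real q" and "d = real del" and "i = 1 / (1 + real del)"
  have di: "d * i = 1 - i"
    by (simp add: d_def i_def field_simps)
  have "total 0 = (x - 1) * (d * i) / 2" "total 1 = x - (x + 1) * (d * i) / 2"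
    by (simp_all add: total_0 total_1 x_def d_def i_def add.commute)
  hence t01: "total 0 = total 1 - x * i"
    unfolding di by (simp add: field_simps)
  have "d * (x * i) = x * (d * i)" by simp
  hence dxi: "d * (x * i) = x - x * i"
    unfolding di by (simp add: algebra_simps)
  have div_i: "y / (1 + real del) = y * i" "y / (real del + 1) = y * i" for y
    by (simp_all add: i_def add.commute)
  show ?thesis
  proof (cases "even (k div gcd k m)")
    case True
    have mo: "odd (m div gcd k m)" using True by (rule odd_m_div)
    have "N = x ^ 2 - (1 + (x - x * i) - i + x * (1 - i) + d * (total 1 - x * i) + (x - d) * total 1)"
      unfolding N_def card_no_root sum_root_sum_even[OF True] div_i t01 x_def d_def by simp
    also have "\<dots> = x * (x - total 1 - 1) + (x + 1) * i - 1"
      using dxi by (simp add: algebra_simps power2_eq_square)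
    finally show ?thesis
      using True mo by (simp add: card_Gamma_image phi_1_1 gcd_Q_q[simplified] gcd_Q_minus_q[simplified] x_def i_def add.commute)
  next
    case odd: False
    show ?thesis
    proof (cases "even (m div gcd k m)")
      case True
      have "N = x ^ 2 - ((x - x * i) + x * total 1)"
        unfolding N_def card_no_root sum_root_sum_odd[OF odd] div_i x_def
        using True by (simp add: gcd_Q_q[simplified])
      also have "\<dots> = x * (x - (1 + total 1 - i) - 1) + (x + 1) - 1"
        by (simp add: algebra_simps power2_eq_square)
      finally show ?thesis
        using True odd by (simp add: card_Gamma_image phi_1_1 gcd_Q_q[simplified] gcd_Q_minus_q[simplified] x_def i_def)
    next
      case False
      have "N = x ^ 2 - ((d + 1) * (x - x * i) + (x - d) * total 1)"
        unfolding N_def card_no_root sum_root_sum_odd[OF odd] div_i x_def d_def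
        using False odd by (simp add: gcd_Q_q[simplified] add.commute)
      also have "\<dots> = (x - d) * (x - total 1 - 1) + (x + 1) - (d + 1)"
        using dxi by (simp add: algebra_simps power2_eq_square)
      finally show ?thesis
        using False odd by (simp add: card_Gamma_image phi_1_1 gcd_Q_q[simplified] gcd_Q_minus_q[simplified] x_def d_def)
    qed
  qed
qed

lemma count_formula_coprime:
  assumes "gcd k m = 1"
  defines "N \<equiv> real (card {C. \<not> (\<exists>a\<in>U. Pval C a = 0)})"
  shows "odd m \<Longrightarrow> N = (real q - 2) * ((real q + 1) / 3)"
    and "even m \<Longrightarrow> N = real q * ((real q - 1) / 3)"
proof -
  have del: "del = 2" using assms(1) by (simp add: del_def)
  have t1: "total 1 = (2 * real q - 1) / 3"
    unfolding total_1 del by (simp add: field_simps)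
  note simps = count_formula[folded N_def] card_Gamma_image phi_1_1 gcd_Q_q[simplified]
    gcd_Q_minus_q[simplified] t1 assms(1) del
  have "even k \<Longrightarrow> odd m" using odd_m_div assms(1) by simp
  thus "odd m \<Longrightarrow> N = (real q - 2) * ((real q + 1) / 3)" "even m \<Longrightarrow> N = real q * ((real q - 1) / 3)"
    by (cases "even k"; simp add: simps; simp add: field_simps)+
qed

end

section \<open>Identification of the given subfield with the fixed points of the
  \<open>q\<close>-Frobenius\<close>

lemma subfield_power_card:
  fixes K :: "'a::finite_field set"
  assumes "subfield K (ring_of_type_algebra :: 'a ring)" "x \<in> K"
  shows "x ^ card K = x"
proof -
  interpret subfield K "ring_of_type_algebra :: 'a ring" by fact
  interpret R: field "ring_of_type_algebra :: 'a ring" by (rule field_from_type_algebra)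
  note subring = subringE[OF subfieldE(1)[OF assms(1)]]
  have mult: "a * b \<in> K" if "a \<in> K" "b \<in> K" for a b
    using subring(6) that by (simp add: ring_of_type_algebra_def)
  have zero: "0 \<in> K"
    using subring(2) by (simp add: ring_of_type_algebra_def)
  show ?thesis
  proof (cases "x = 0")
    case True
    thus ?thesis using zero card_gt_0_iff[of K] by (auto simp: power_0_left)
  next
    case False
    \<comment> \<open>Multiplication by \<open>x\<close> permutes the nonzero elements of
      \<open>K\<close>; comparing the products gives Fermat's identity.\<close>
    have "(\<lambda>y. x * y) ` (K - {0}) = K - {0}"
      by (rule endo_inj_surj) (use False assms(2) mult in \<open>auto simp: inj_on_def\<close>)
    hence "\<Prod>(K - {0}) = (\<Prod>y\<in>(\<lambda>y. x * y) ` (K - {0}). y)" by simp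
    also have "\<dots> = (\<Prod>y\<in>K - {0}. x * y)"
      by (rule prod.reindex_cong[of "\<lambda>y. x * y"]) (use False in \<open>auto simp: inj_on_def\<close>)
    also have "\<dots> = x ^ (card K - 1) * \<Prod>(K - {0})"
      using zero by (simp add: prod.distrib card_Diff_singleton)
    finally have "x ^ (card K - 1) = 1" by simp
    moreover have "card K > 0" using zero by (auto simp: card_gt_0_iff)
    ultimately show ?thesis
      by (metis Suc_diff_1 mult.right_neutral power_Suc)
  qed
qed

theorem theorem10:
  fixes K :: "'a::finite_field set" and m n q k N :: nat
  assumes "m \<ge> 1" and "n = 2 * m" and "q = 2 ^ m"
    and "CARD('a) = q ^ 2"
    and "subfield K (ring_of_type_algebra :: 'a ring)" and "card K = q"
    and "1 \<le> k" and "k < n"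
    and "N = card {C :: 'a. \<not> (\<exists>x \<in> nonzero_powers (q - 1). poly (P_poly q k C) x = 0)}"
  shows "real N =
           (real q - real (gcd (2 ^ k + 1) (q + 1)) + 1)
             * (real q - real (card (Gamma_map k ` K)) - 1)
           + (real q + 1) / real (gcd (2 ^ k - 1) (q + 1))
           - real (gcd (2 ^ k + 1) (q + 1))
         \<and> (gcd k m = 1 \<longrightarrow>
              (odd m \<longrightarrow> real N = (real q - 2) * ((real q + 1) / 3)) \<and>
              (even m \<longrightarrow> real N = real q * ((real q - 1) / 3)))"
proof -
  interpret F: char2_quadratic m k q "2 ^ k" "TYPE('a)"
    by (rule char2_quadratic.intro) (use assms(1,3,4,7) in simp_all)
  have "K \<subseteq> F.K"
    using subfield_power_card[OF assms(5)] assms(6) by (auto simp: F.K_def)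
  \<comment> \<open>The inclusion becomes an equality because both sets have \<open>q\<close>
    elements.\<close>
  hence K: "K = F.K"
    using assms(6) F.card_K by (intro card_subset_eq) auto
  have N: "N = card {C. \<not> (\<exists>a\<in>F.U. F.Pval C a = 0)}"
    by (simp only: assms(9) F.nonzero_powers_eq_U F.poly_P_poly)
  show ?thesis
    unfolding N K by (intro conjI impI; (rule F.count_formula | rule F.count_formula_coprime, assumption+))
qed

end
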